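(* Assume (A1), and assume (C3) holds for some $p>2$. Suppose $h_n=n^{-\theta_2}(\log n)^{\theta_1}$ for some $\theta_1,\theta_2>0$. Let $a,b\ge0$ and set $$v_n=\frac{n^a(\log n)^b}{(nh_n)^{d/2}},\qquad \theta=\frac{2a(d+p)-d^2-2}{d(3d+2)}.$$ If $\theta\ge\theta_2$ and $d(3d+2)\theta_1+2(d+p)b>2$, then $$\sup_{x\in[0,1]^d}|g_n(x)-Eg_n(x)|=O_{a.s.}[v_n].$$
   Context: Fix an integer $d\ge1$. For $x=(x_1,\dots,x_d)\in\mathbb{R}^d$ let $\|x\|=\max_{1\le k\le d}|x_k|$; for $i,j\in\mathbb{Z}^d$ let $|i-j|=\max_{1\le l\le d}|i_l-j_l|$, and $|k|=|k-0|$. Let $(\varepsilon_i)_{i\in\mathbb{Z}^d}$ be a strictly stationary real random field on a probability space $(\Omega,\mathcal F,\mathbb P)$ with $E\varepsilon_0=0$. Strict stationarity means: for all $k\in\mathbb{Z}^d$, $n\ge1$ and $i_1,\dots,i_n\in\mathbb{Z}^d$, the vectors $(\varepsilon_{i_1},\dots,\varepsilon_{i_n})$ and $(\varepsilon_{i_1+k},\dots,\varepsilon_{i_n+k})$ have the same law. Let $g:[0,1]^d\to\mathbb{R}$ and $\Lambda_n=\{1,\dots,n\}^d$, and set $Y_i=g(i/n)+\varepsilon_i$ for $i\in\Lambda_n$. Let $K$ be a probability density on $\mathbb{R}^d$ and $(h_n)_{n\ge1}$ positive numbers with $h_n\to0$ and $nh_n\to\infty$. For $x\in[0,1]^d$ define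 $$g_n(x)=\frac{\sum_{i\in\Lambda_n}Y_i\,K\big((x-i/n)/h_n\big)}{\sum_{i\in\Lambda_n}K\big((x-i/n)/h_n\big)}.$$ Assumption (A1): $K$ is symmetric and nonnegative, and supported in $[-1,1]^d$. There is $\eta>0$ with $|K(x)-K(y)|\le\eta\|x-y\|$ for all $x,y\in[-1,1]^d$, and there are constants $c,C>0$ with $c\le K(x)\le C$ for all $x\in[-1,1]^d$. Notation $O_{a.s.}$: for real random variables $Z_n$ and positive numbers $v_n$, $Z_n=O_{a.s.}[v_n]$ means there exists a deterministic $\lambda>0$ with $\limsup_{n\to\infty}|Z_n|/v_n\le\lambda$ almost surely. Dependence notation: $i<_{lex}j$ for distinct $i,j\in\mathbb{Z}^d$ means either $i_1<j_1$, or for some $p\in\{2,\dots,d\}$ one has $i_p<j_p$ and $i_q=j_q$ for $1\le q<p$. Set $V_i^1=\{j\in\mathbb{Z}^d: j<_{lex}i\}$ and, for integers $m\ge2$, $V_i^m=V_i^1\cap\{j:|i-j|\ge m\}$. For $\Gamma\subset\mathbb{Z}^d$ let $\mathcal F_\Gamma=\sigma(\varepsilon_j: j\in\Gamma)$. For $k\in V_0^1$ (so $|k|\ge1$) put $E_{|k|}(\varepsilon_0)=E(\varepsilon_0\mid\mathcal F_{V_0^{|k|}})$. Condition (C3) (for a given $p>2$): $\varepsilon_0\in L^p$ and $\sum_{k\in V_0^1}\|\varepsilon_kE_{|k|}(\varepsilon_0)\|_{p/2}<\infty$. *)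

theory Defs
  imports "HOL-Probability.Probability"
begin

text \<open>Index set Z^d is rendered as int^'d, R^d as real^'d, with d = CARD('d).
 The linear order on 'd fixes the coordinate order 1,...,d used in the lexicographic order.\<close>

definition supnormR :: "real^'d \<Rightarrow> real" where
  "supnormR x = Max (range (\<lambda>l. \<bar>x $ l\<bar>))"

definition supnormZ :: "int^'d \<Rightarrow> int" where
  "supnormZ k = Max (range (\<lambda>l. \<bar>k $ l\<bar>))"

definition lex_less :: "(int, 'd::{finite,linorder}) vec \<Rightarrow> (int, 'd) vec \<Rightarrow> bool" where
  "lex_less i j \<longleftrightarrow> (\<exists>p. i $ p < j $ p \<and> (\<forall>q. q < p \<longrightarrow> i $ q = j $ q))"

text \<open>V_i^m = {j. j <lex i, |i - j| >= m}; for m = 1 this is V_i^1 since distinct points have distance >= 1.\<close>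
definition Vset :: "(int, 'd::{finite,linorder}) vec \<Rightarrow> int \<Rightarrow> (int, 'd) vec set" where
  "Vset i m = {j. lex_less j i \<and> supnormZ (i - j) \<ge> m}"

definition gen_sigma :: "'a measure \<Rightarrow> ('i \<Rightarrow> 'a \<Rightarrow> real) \<Rightarrow> 'i set \<Rightarrow> 'a measure" where
  "gen_sigma M X \<Gamma> = sigma (space M) {X j -` A \<inter> space M | j A. j \<in> \<Gamma> \<and> A \<in> sets borel}"

definition Lnorm :: "'a measure \<Rightarrow> real \<Rightarrow> ('a \<Rightarrow> real) \<Rightarrow> real" where
  "Lnorm M q X = (\<integral>\<omega>. \<bar>X \<omega>\<bar> powr q \<partial>M) powr (1 / q)"

definition strictly_stationary :: "'a measure \<Rightarrow> (int^'d \<Rightarrow> 'a \<Rightarrow> real) \<Rightarrow> bool" where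
  "strictly_stationary M X \<longleftrightarrow>
     (\<forall>k J. finite J \<longrightarrow>
        distr M (PiM J (\<lambda>_. borel)) (\<lambda>\<omega>. \<lambda>i\<in>J. X i \<omega>)
      = distr M (PiM J (\<lambda>_. borel)) (\<lambda>\<omega>. \<lambda>i\<in>J. X (i + k) \<omega>))"

definition Lambda_n :: "nat \<Rightarrow> (int^'d) set" where
  "Lambda_n n = {i. \<forall>l. 1 \<le> i $ l \<and> i $ l \<le> int n}"

definition unit_cube :: "(real^'d) set" where
  "unit_cube = {x. \<forall>l. 0 \<le> x $ l \<and> x $ l \<le> 1}"

definition scaled_index :: "nat \<Rightarrow> int^'d \<Rightarrow> real^'d" where
  "scaled_index n i = (\<chi> l. real_of_int (i $ l) / real n)"

text \<open>Nadaraya-Watson type estimator g_n(x), with Y_i = g(i/n) + eps_i.\<close>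
definition g_est :: "(real^'d \<Rightarrow> real) \<Rightarrow> (int^'d \<Rightarrow> 'a \<Rightarrow> real) \<Rightarrow> (real^'d \<Rightarrow> real)
     \<Rightarrow> (nat \<Rightarrow> real) \<Rightarrow> nat \<Rightarrow> real^'d \<Rightarrow> 'a \<Rightarrow> real" where
  "g_est g X K h n x \<omega> =
     (\<Sum>i\<in>Lambda_n n. (g (scaled_index n i) + X i \<omega>) * K ((1 / h n) *\<^sub>R (x - scaled_index n i)))
   / (\<Sum>i\<in>Lambda_n n. K ((1 / h n) *\<^sub>R (x - scaled_index n i)))"

definition O_as :: "'a measure \<Rightarrow> (nat \<Rightarrow> 'a \<Rightarrow> real) \<Rightarrow> (nat \<Rightarrow> real) \<Rightarrow> bool" where
  "O_as M Z v \<longleftrightarrow> (\<exists>lam>0. AE \<omega> in M. limsup (\<lambda>n. ereal (\<bar>Z n \<omega>\<bar> / v n)) \<le> ereal lam)"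

end

theory Submission
  imports Defs "HOL-Real_Asymp.Real_Asymp"
begin

text \<open>
  The centred estimator is \<open>S\<^sub>n(x) / D\<^sub>n(x)\<close>, where \<open>S\<^sub>n(x)\<close> is the kernel-weighted sum of the noise and
  \<open>D\<^sub>n(x)\<close> is of order \<open>(n h\<^sub>n)\<^sup>d\<close>. Condition (C3) yields Dedecker's moment inequality
  \<open>E |\<Sum> w\<^sub>i \<epsilon>\<^sub>i|\<^sup>p \<le> const (W\<^sup>2 card B)\<^bsup>p/2\<^esup>\<close> for sums over a finite set \<open>B\<close> with weights bounded by \<open>W\<close>.

  The kernel jumps at the boundary of its support, so \<open>S\<^sub>n\<close> is not Lipschitz in \<open>x\<close>. The kernel is
  therefore split into a Lipschitz weight, which may be frozen at a nearby grid point, and the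
  indicator of a moving box. The supremum over boxes is controlled by a Rademacher-Menshov argument:
  a box is a combination of polylogarithmically many dyadic boxes. The error of freezing the weight
  is at most \<open>\<Sum> |\<epsilon>\<^sub>i|\<close> over the whole of \<open>\<Lambda>\<^sub>n\<close> times (mesh / \<open>h\<^sub>n\<close>), and this monotone sum is bounded
  almost surely by a multiple of \<open>n\<^bsup>d + \<delta>\<^esup>\<close>, by Borel-Cantelli along powers of two.
  With mesh \<open>n\<^bsup>-\<mu>\<^esup>\<close>, where \<open>\<mu> = (a p - 1) / d - \<theta>\<^sub>2 / 2\<close>, the hypothesis \<open>\<theta> \<ge> \<theta>\<^sub>2\<close> leaves polynomial room for the logarithms and for \<open>\<delta>\<close>.
\<close>

subsection \<open>Inequalities for powers\<close>

text \<open>At 0 the difference quotient is \<open>\<bar>y\<bar> powr (q - 1)\<close>, which tends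
  to 0 because q > 1. Taken at q = p - 1 this supplies the second derivative of
  \<open>\<bar>x\<bar> powr p\<close>.\<close>

lemma signed_powr_has_derivative:
  fixes q x :: real
  assumes "q > 1"
  shows "((\<lambda>x. sgn x * \<bar>x\<bar> powr q) has_real_derivative q * \<bar>x\<bar> powr (q - 1)) (at x)"
proof -
  consider "x > 0" | "x < 0" | "x = 0" by linarith
  then show ?thesis
  proof cases
    case 1
    have "((\<lambda>x. x powr q) has_real_derivative q * x powr (q - 1)) (at x)"
      using 1 by (auto intro!: derivative_eq_intros)
    moreover have "eventually (\<lambda>y. sgn y * \<bar>y\<bar> powr q = y powr q) (nhds x)"
      using eventually_nhds_in_open[of "{0<..}" x] 1
      by (auto elim!: eventually_mono)
    ultimately show ?thesis
      using 1 by (subst DERIV_cong_ev[OF refl _ refl]) auto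
  next
    case 2
    have "((\<lambda>x. - ((- x) powr q)) has_real_derivative q * (- x) powr (q - 1)) (at x)"
      using 2 by (auto intro!: derivative_eq_intros)
    moreover have "eventually (\<lambda>y. sgn y * \<bar>y\<bar> powr q = - ((- y) powr q)) (nhds x)"
      using eventually_nhds_in_open[of "{..<0}" x] 2
      by (auto elim!: eventually_mono)
    ultimately show ?thesis
      using 2 by (subst DERIV_cong_ev[OF refl _ refl]) auto
  next
    case 3
    have "((\<lambda>y. \<bar>y\<bar> powr (q - 1)) \<longlongrightarrow> \<bar>0::real\<bar> powr (q - 1)) (at 0)"
      using assms by (intro tendsto_intros) auto
    moreover have "sgn y * \<bar>y\<bar> powr q / y = \<bar>y\<bar> powr (q - 1)" if "y \<noteq> 0" for y :: real
      using that by (auto simp: sgn_if powr_diff field_simps)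
    ultimately have "((\<lambda>y. sgn y * \<bar>y\<bar> powr q / y) \<longlongrightarrow> 0) (at 0)"
      by (subst LIM_equal[of 0 _ "\<lambda>y. \<bar>y\<bar> powr (q - 1)"]) auto
    then show ?thesis
      using 3 by (simp add: DERIV_def)
  qed
qed

lemma abs_powr_has_derivative:
  fixes q x :: real
  assumes "q > 1"
  shows "((\<lambda>x. \<bar>x\<bar> powr q) has_real_derivative q * (sgn x * \<bar>x\<bar> powr (q - 1))) (at x)"
proof -
  consider "x > 0" | "x < 0" | "x = 0" by linarith
  then show ?thesis
  proof cases
    case 1
    have "((\<lambda>x. x powr q) has_real_derivative q * x powr (q - 1)) (at x)"
      using 1 by (auto intro!: derivative_eq_intros)
    moreover have "eventually (\<lambda>y. \<bar>y\<bar> powr q = y powr q) (nhds x)"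
      using eventually_nhds_in_open[of "{0<..}" x] 1
      by (auto elim!: eventually_mono)
    ultimately show ?thesis
      using 1 by (subst DERIV_cong_ev[OF refl _ refl]) auto
  next
    case 2
    have "((\<lambda>x. (- x) powr q) has_real_derivative q * (- ((- x) powr (q - 1)))) (at x)"
      using 2 by (auto intro!: derivative_eq_intros)
    moreover have "eventually (\<lambda>y. \<bar>y\<bar> powr q = (- y) powr q) (nhds x)"
      using eventually_nhds_in_open[of "{..<0}" x] 2
      by (auto elim!: eventually_mono)
    ultimately show ?thesis
      using 2 by (subst DERIV_cong_ev[OF refl _ refl]) auto
  next
    case 3
    have "((\<lambda>y. sgn y * \<bar>y\<bar> powr (q - 1)) \<longlongrightarrow> 0) (at 0)"
    proof (rule Lim_null_comparison)
      have "((\<lambda>y. \<bar>y\<bar> powr (q - 1)) \<longlongrightarrow> \<bar>0::real\<bar> powr (q - 1)) (at 0)"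
        using assms by (intro tendsto_intros) auto
      then show "((\<lambda>y::real. \<bar>y\<bar> powr (q - 1)) \<longlongrightarrow> 0) (at 0)" by simp
    qed (auto simp: sgn_if abs_mult)
    moreover have "\<bar>y\<bar> powr q / y = sgn y * \<bar>y\<bar> powr (q - 1)" if "y \<noteq> 0" for y :: real
      using that by (auto simp: sgn_if powr_diff field_simps)
    ultimately have "((\<lambda>y. \<bar>y\<bar> powr q / y) \<longlongrightarrow> 0) (at 0)"
      by (subst LIM_equal[of 0 _ "\<lambda>y. sgn y * \<bar>y\<bar> powr (q - 1)"]) auto
    then show ?thesis
      using 3 by (simp add: DERIV_def)
  qed
qed

text \<open>The order of u and v is left open because both will be random sums whose increment has
  no fixed sign.\<close>

lemma MVT_between:
  fixes f f' :: "real \<Rightarrow> real"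
  assumes "\<And>x. (f has_real_derivative f' x) (at x)"
  obtains z where "min u v \<le> z" "z \<le> max u v" "f v - f u = (v - u) * f' z"
proof -
  consider "u < v" | "v < u" | "u = v" by linarith
  then show ?thesis
  proof cases
    case 1
    then obtain z where "u < z" "z < v" "f v - f u = (v - u) * f' z" using MVT2[of u v f f'] assms by blast
    then show ?thesis using that[of z] by auto
  next
    case 2
    then obtain z where "v < z" "z < u" "f u - f v = (u - v) * f' z" using MVT2[of v u f f'] assms by blast
    then show ?thesis using that[of z] by (auto simp: algebra_simps)
  next
    case 3 then show ?thesis using that[of u] by auto
  qed
qed

lemma signed_powr_diff_bound:
  fixes p u v B :: real
  assumes p: "p > 2" and "\<bar>u\<bar> \<le> B" "\<bar>v\<bar> \<le> B"
  shows "\<bar>sgn v * \<bar>v\<bar> powr (p - 1) - sgn u * \<bar>u\<bar> powr (p - 1)\<bar> \<le> (p - 1) * \<bar>v - u\<bar> * B powr (p - 2)"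
proof -
  obtain z where z: "min u v \<le> z" "z \<le> max u v"
    and eq: "sgn v * \<bar>v\<bar> powr (p - 1) - sgn u * \<bar>u\<bar> powr (p - 1) = (v - u) * ((p - 1) * \<bar>z\<bar> powr (p - 1 - 1))"
    using MVT_between[OF signed_powr_has_derivative[of "p - 1"], of u v] p by auto
  have "\<bar>z\<bar> powr (p - 2) \<le> B powr (p - 2)"
    using z assms by (intro powr_mono2) auto
  then show ?thesis
    unfolding eq using p mult_left_mono[of "\<bar>z\<bar> powr (p - 2)" "B powr (p - 2)" "\<bar>v - u\<bar> * (p - 1)"]
    by (simp add: abs_mult mult_ac)
qed

lemma max_powr_le_sum:
  fixes u v q :: real
  shows "max \<bar>u\<bar> \<bar>v\<bar> powr q \<le> \<bar>u\<bar> powr q + \<bar>v\<bar> powr q"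
  by (auto simp: max_def)

text \<open>The maximum is traded for a sum so that, under the integral, each summand meets
  Hoelder's inequality with the moment of a single partial sum.\<close>

lemma signed_powr_diff_bound_sum:
  fixes p u v :: real
  assumes p: "p > 2"
  shows "\<bar>sgn v * \<bar>v\<bar> powr (p - 1) - sgn u * \<bar>u\<bar> powr (p - 1)\<bar>
    \<le> (p - 1) * \<bar>v - u\<bar> * (\<bar>u\<bar> powr (p - 2) + \<bar>v\<bar> powr (p - 2))"
  using p by (intro order.trans[OF signed_powr_diff_bound[of p u "max \<bar>u\<bar> \<bar>v\<bar>" v]]
      mult_left_mono max_powr_le_sum) auto

text \<open>Mean value expansion with the derivative at the intermediate point replaced by the one
  at u, paid for by the bound on signed powers. The remainder involves u + v and not v alone, so
  that only moments of partial sums occur when u and u + v are two of them.\<close>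

lemma abs_powr_taylor_bound:
  fixes p u v :: real
  assumes p: "p > 2"
  shows "\<bar>u + v\<bar> powr p \<le> \<bar>u\<bar> powr p + p * (sgn u * \<bar>u\<bar> powr (p - 1)) * v
    + p * (p - 1) * v\<^sup>2 * (\<bar>u\<bar> powr (p - 2) + \<bar>u + v\<bar> powr (p - 2))"
proof -
  define B where "B = max \<bar>u\<bar> \<bar>u + v\<bar>"
  define \<phi> where "\<phi> = (\<lambda>x. sgn x * \<bar>x\<bar> powr (p - 1))"
  obtain z where z: "min u (u + v) \<le> z" "z \<le> max u (u + v)"
    and eq: "\<bar>u + v\<bar> powr p - \<bar>u\<bar> powr p = (u + v - u) * (p * (sgn z * \<bar>z\<bar> powr (p - 1)))"
    using MVT_between[OF abs_powr_has_derivative[of p], of u "u + v"] p by auto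
  have "\<bar>\<phi> z - \<phi> u\<bar> \<le> (p - 1) * \<bar>z - u\<bar> * B powr (p - 2)"
    unfolding \<phi>_def using z p by (intro signed_powr_diff_bound) (auto simp: B_def)
  also have "\<dots> \<le> (p - 1) * \<bar>v\<bar> * (\<bar>u\<bar> powr (p - 2) + \<bar>u + v\<bar> powr (p - 2))"
    using z p unfolding B_def by (intro mult_mono max_powr_le_sum mult_left_mono) auto
  finally have "p * \<bar>v\<bar> * \<bar>\<phi> z - \<phi> u\<bar> \<le> p * \<bar>v\<bar> * ((p - 1) * \<bar>v\<bar> * (\<bar>u\<bar> powr (p - 2) + \<bar>u + v\<bar> powr (p - 2)))"
    using p by (intro mult_left_mono) auto
  also have "\<dots> = p * (p - 1) * v\<^sup>2 * (\<bar>u\<bar> powr (p - 2) + \<bar>u + v\<bar> powr (p - 2))"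
    by (simp add: power2_eq_square mult_ac)
  finally have "p * (v * (\<phi> z - \<phi> u)) \<le> p * (p - 1) * v\<^sup>2 * (\<bar>u\<bar> powr (p - 2) + \<bar>u + v\<bar> powr (p - 2))"
    using p abs_ge_self[of "v * (\<phi> z - \<phi> u)"] mult_left_mono[of "v * (\<phi> z - \<phi> u)" "\<bar>v * (\<phi> z - \<phi> u)\<bar>" p]
    by (simp add: abs_mult mult.assoc)
  moreover have "\<bar>u + v\<bar> powr p = \<bar>u\<bar> powr p + p * \<phi> u * v + p * (v * (\<phi> z - \<phi> u))"
    using eq by (simp add: \<phi>_def algebra_simps)
  ultimately show ?thesis by (simp add: \<phi>_def)
qed

text \<open>Hoelder's inequality for the conjugate exponents p/2 and p/(p - 2).\<close>

lemma Holder_mixed_powr: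
  fixes U T :: "'a \<Rightarrow> real"
  assumes p: "p > 2"
    and [measurable]: "U \<in> borel_measurable M" "T \<in> borel_measurable M"
    and U: "integrable M (\<lambda>x. \<bar>U x\<bar> powr (p / 2))" and T: "integrable M (\<lambda>x. \<bar>T x\<bar> powr p)"
  shows "integrable M (\<lambda>x. \<bar>U x\<bar> * \<bar>T x\<bar> powr (p - 2))"
    and "(\<integral>x. \<bar>U x\<bar> * \<bar>T x\<bar> powr (p - 2) \<partial>M)
      \<le> (\<integral>x. \<bar>U x\<bar> powr (p / 2) \<partial>M) powr (2 / p) * (\<integral>x. \<bar>T x\<bar> powr p \<partial>M) powr ((p - 2) / p)"
proof -
  define u where "u = (\<integral>x. \<bar>U x\<bar> powr (p / 2) \<partial>M)"
  define t where "t = (\<integral>x. \<bar>T x\<bar> powr p \<partial>M)"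
  \<comment> \<open>The normalisers stay free: the values 1 and 1 give an integrable majorant, the
    two integrals themselves give the product bound.\<close>
  have young: "\<bar>U x\<bar> * \<bar>T x\<bar> powr (p - 2)
      \<le> (u' powr (2 / p) * t' powr ((p - 2) / p)) * (2 / p * (\<bar>U x\<bar> powr (p / 2) / u') + (p - 2) / p * (\<bar>T x\<bar> powr p / t'))"
    if "u' > 0" "t' > 0" for x u' t'
  proof (cases "U x = 0 \<or> T x = 0")
    case True
    then show ?thesis using p that by auto
  next
    case False
    have "(\<bar>U x\<bar> powr (p / 2) / u') powr (2 / p) * (\<bar>T x\<bar> powr p / t') powr ((p - 2) / p)
      \<le> 2 / p * (\<bar>U x\<bar> powr (p / 2) / u') + (p - 2) / p * (\<bar>T x\<bar> powr p / t')"
      using p that False by (intro Youngs_inequality_0) (auto simp: field_simps)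
    moreover have "(\<bar>U x\<bar> powr (p / 2) / u') powr (2 / p) * (\<bar>T x\<bar> powr p / t') powr ((p - 2) / p)
        = \<bar>U x\<bar> * \<bar>T x\<bar> powr (p - 2) / (u' powr (2 / p) * t' powr ((p - 2) / p))"
      using that p False by (simp add: powr_divide powr_powr)
    ultimately have "\<bar>U x\<bar> * \<bar>T x\<bar> powr (p - 2) / (u' powr (2 / p) * t' powr ((p - 2) / p))
        \<le> 2 / p * (\<bar>U x\<bar> powr (p / 2) / u') + (p - 2) / p * (\<bar>T x\<bar> powr p / t')"
      by simp
    then show ?thesis using that by (subst (asm) pos_divide_le_eq) (auto simp: mult.commute)
  qed
  show int: "integrable M (\<lambda>x. \<bar>U x\<bar> * \<bar>T x\<bar> powr (p - 2))"
  proof (rule Bochner_Integration.integrable_bound)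
    show "integrable M (\<lambda>x. 2 / p * \<bar>U x\<bar> powr (p / 2) + (p - 2) / p * \<bar>T x\<bar> powr p)"
      using U T by auto
    show "AE x in M. norm (\<bar>U x\<bar> * \<bar>T x\<bar> powr (p - 2)) \<le> norm (2 / p * \<bar>U x\<bar> powr (p / 2) + (p - 2) / p * \<bar>T x\<bar> powr p)"
      using young[of 1 1] p by (auto intro: order.trans[OF _ abs_ge_self])
  qed auto
  have "u \<ge> 0" "t \<ge> 0" unfolding u_def t_def by auto
  \<comment> \<open>A vanishing integral cannot serve as normaliser; in that case the product is 0
    almost everywhere.\<close>
  then consider "u = 0" | "t = 0" | "u > 0" "t > 0" by linarith
  then have "(\<integral>x. \<bar>U x\<bar> * \<bar>T x\<bar> powr (p - 2) \<partial>M) \<le> u powr (2 / p) * t powr ((p - 2) / p)"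
  proof cases
    case 1
    then have "AE x in M. \<bar>U x\<bar> powr (p / 2) = 0"
      unfolding u_def using U by (subst (asm) integral_nonneg_eq_0_iff_AE) auto
    then have "AE x in M. \<bar>U x\<bar> * \<bar>T x\<bar> powr (p - 2) = 0" by auto
    then show ?thesis by (subst integral_eq_zero_AE) auto
  next
    case 2
    then have "AE x in M. \<bar>T x\<bar> powr p = 0"
      unfolding t_def using T by (subst (asm) integral_nonneg_eq_0_iff_AE) auto
    then have "AE x in M. \<bar>U x\<bar> * \<bar>T x\<bar> powr (p - 2) = 0" by auto
    then show ?thesis by (subst integral_eq_zero_AE) auto
  next
    case 3
    have "(\<integral>x. \<bar>U x\<bar> * \<bar>T x\<bar> powr (p - 2) \<partial>M) \<le>
      (\<integral>x. (u powr (2 / p) * t powr ((p - 2) / p)) * (2 / p * (\<bar>U x\<bar> powr (p / 2) / u) + (p - 2) / p * (\<bar>T x\<bar> powr p / t)) \<partial>M)"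
      using int U T young 3 by (intro integral_mono) auto
    also have "\<dots> = (u powr (2 / p) * t powr ((p - 2) / p)) * (2 / p * (u / u) + (p - 2) / p * (t / t))"
      using U T by (simp add: u_def t_def)
    also have "\<dots> = u powr (2 / p) * t powr ((p - 2) / p)"
      using 3 p by (simp add: field_simps)
    finally show ?thesis .
  qed
  then show "(\<integral>x. \<bar>U x\<bar> * \<bar>T x\<bar> powr (p - 2) \<partial>M)
      \<le> (\<integral>x. \<bar>U x\<bar> powr (p / 2) \<partial>M) powr (2 / p) * (\<integral>x. \<bar>T x\<bar> powr p \<partial>M) powr ((p - 2) / p)"
    unfolding u_def t_def .
qed

subsection \<open>The moment inequality\<close>

lemma supnormZ_minus_commute: "supnormZ (i - j) = supnormZ (j - i)"
  unfolding supnormZ_def by (simp add: abs_minus_commute)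

lemma supnormZ_ge_one:
  assumes "lex_less j i"
  shows "supnormZ (i - j) \<ge> 1"
proof -
  obtain q where "j $ q < i $ q" using assms by (auto simp: lex_less_def)
  then have "1 \<le> \<bar>(i - j) $ q\<bar>" by simp
  also have "\<dots> \<le> supnormZ (i - j)" unfolding supnormZ_def by (intro Max_ge) auto
  finally show ?thesis .
qed

lemma lex_less_diff_iff: "lex_less (i - k) (j - k) \<longleftrightarrow> lex_less i j"
  by (simp add: lex_less_def)

text \<open>Order and distance are translation invariant, which moves the past of j to the past of
  the origin, where (C3) is formulated.\<close>

lemma Vset_shift: "i \<in> Vset j m \<longleftrightarrow> i - j \<in> Vset 0 m"
  using lex_less_diff_iff[of i j j] by (simp add: Vset_def supnormZ_minus_commute[of j i])

lemma lex_less_trans: "lex_less i j \<Longrightarrow> lex_less j k \<Longrightarrow> lex_less i k"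
  unfolding lex_less_def
  by (metis (no_types, lifting) linorder_less_linear order.strict_trans)

lemma lex_less_total:
  assumes "i \<noteq> j"
  shows "lex_less i j \<or> lex_less j i"
proof -
  \<comment> \<open>The first coordinate at which i and j differ decides the comparison.\<close>
  define D where "D = {q. i $ q \<noteq> j $ q}"
  have "D \<noteq> {}" using assms by (auto simp: D_def vec_eq_iff)
  then have "Min D \<in> D" by (intro Min_in) auto
  moreover have "i $ q = j $ q" if "q < Min D" for q
  proof (rule ccontr)
    assume "i $ q \<noteq> j $ q"
    then have "Min D \<le> q" by (intro Min_le) (auto simp: D_def)
    then show False using that by simp
  qed
  ultimately show ?thesis unfolding lex_less_def D_def
    by (metis (mono_tags, lifting) linorder_neqE mem_Collect_eq)
qed

text \<open>Provides the point to split off in an induction on the index set: every other point lies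
  in its past.\<close>

lemma finite_lex_greatest:
  assumes "finite A" "A \<noteq> {}"
  obtains j where "j \<in> A" "A - {j} \<subseteq> Vset j 1"
proof -
  have "\<exists>j\<in>A. \<forall>i\<in>A. i \<noteq> j \<longrightarrow> lex_less i j"
  proof (rule Finite_Set.bex_greatest_element)
    show "transp_on A lex_less" by (rule transp_onI) (rule lex_less_trans)
    show "totalp_on A lex_less" by (rule totalp_onI) (rule lex_less_total)
  qed (use assms in auto)
  then show ?thesis using that supnormZ_ge_one by (auto simp: Vset_def)
qed

lemma space_gen_sigma [simp]: "space (gen_sigma M X \<Gamma>) = space M"
  unfolding gen_sigma_def by (rule space_measure_of) auto

lemma sets_gen_sigma: "sets (gen_sigma M X \<Gamma>) = sigma_sets (space M) {X j -` A \<inter> space M | j A. j \<in> \<Gamma> \<and> A \<in> sets borel}"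
  unfolding gen_sigma_def by (rule sets_measure_of) auto

lemma subalgebra_gen_sigma:
  assumes "\<And>j. j \<in> \<Gamma> \<Longrightarrow> X j \<in> borel_measurable M"
  shows "subalgebra M (gen_sigma M X \<Gamma>)"
  unfolding subalgebra_def sets_gen_sigma
  using assms by (auto intro!: sets.sigma_sets_subset)

lemma measurable_gen_sigma:
  assumes "j \<in> \<Gamma>"
  shows "X j \<in> borel_measurable (gen_sigma M X \<Gamma>)"
  using assms by (intro measurableI) (auto simp: sets_gen_sigma)

lemma abs_add_powr_le:
  fixes u v p :: real
  assumes "p > 0"
  shows "\<bar>u + v\<bar> powr p \<le> 2 powr p * (\<bar>u\<bar> powr p + \<bar>v\<bar> powr p)"
proof -
  have "\<bar>u + v\<bar> powr p \<le> (2 * max \<bar>u\<bar> \<bar>v\<bar>) powr p"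
    using assms by (intro powr_mono2) auto
  also have "\<dots> = 2 powr p * max \<bar>u\<bar> \<bar>v\<bar> powr p" by (simp add: powr_mult)
  also have "\<dots> \<le> 2 powr p * (\<bar>u\<bar> powr p + \<bar>v\<bar> powr p)"
    by (intro mult_left_mono max_powr_le_sum) auto
  finally show ?thesis .
qed

lemma integrable_abs_powr_add:
  fixes U V :: "'a \<Rightarrow> real"
  assumes "p > 0" and [measurable]: "U \<in> borel_measurable M" "V \<in> borel_measurable M"
    and "integrable M (\<lambda>x. \<bar>U x\<bar> powr p)" "integrable M (\<lambda>x. \<bar>V x\<bar> powr p)"
  shows "integrable M (\<lambda>x. \<bar>U x + V x\<bar> powr p)"
proof (rule Bochner_Integration.integrable_bound)
  show "integrable M (\<lambda>x. 2 powr p * (\<bar>U x\<bar> powr p + \<bar>V x\<bar> powr p))" using assms by auto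
  show "AE x in M. norm (\<bar>U x + V x\<bar> powr p) \<le> norm (2 powr p * (\<bar>U x\<bar> powr p + \<bar>V x\<bar> powr p))"
    using abs_add_powr_le[OF assms(1)] by auto
qed auto

text \<open>Only integrability matters, so a crude majorant suffices: both factors are bounded
  through the larger of \<open>\<bar>u\<bar>\<close> and \<open>\<bar>v\<bar>\<close>.\<close>

lemma integrable_signed_powr_mult:
  fixes U V :: "'a \<Rightarrow> real"
  assumes "p > 1" and [measurable]: "U \<in> borel_measurable M" "V \<in> borel_measurable M"
    and "integrable M (\<lambda>x. \<bar>U x\<bar> powr p)" "integrable M (\<lambda>x. \<bar>V x\<bar> powr p)"
  shows "integrable M (\<lambda>x. sgn (U x) * \<bar>U x\<bar> powr (p - 1) * V x)"
proof (rule Bochner_Integration.integrable_bound)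
  show "integrable M (\<lambda>x. \<bar>U x\<bar> powr p + \<bar>V x\<bar> powr p)" using assms by auto
  have "\<bar>u\<bar> powr (p - 1) * \<bar>v\<bar> \<le> \<bar>u\<bar> powr p + \<bar>v\<bar> powr p" for u v :: real
  proof -
    have "\<bar>u\<bar> powr (p - 1) * \<bar>v\<bar> \<le> max \<bar>u\<bar> \<bar>v\<bar> powr (p - 1) * max \<bar>u\<bar> \<bar>v\<bar> powr 1"
      using assms by (intro mult_mono powr_mono2) auto
    also have "\<dots> = max \<bar>u\<bar> \<bar>v\<bar> powr p" by (simp only: powr_add[symmetric]) simp
    finally show ?thesis using max_powr_le_sum[of u v p] by linarith
  qed
  then show "AE x in M. norm (sgn (U x) * \<bar>U x\<bar> powr (p - 1) * V x) \<le> norm (\<bar>U x\<bar> powr p + \<bar>V x\<bar> powr p)"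
    by (intro AE_I2) (auto simp: abs_mult abs_sgn_eq)
qed auto

text \<open>(C3) takes two assumptions: \<open>Lnorm\<close> rests on the Bochner integral, which is
  0 for a non-integrable function, so finiteness of each norm is required separately from
  summability of the norms.\<close>

locale C3_field = prob_space M
  for M :: "'a measure" +
  fixes eps :: "(int, 'd::{finite,linorder}) vec \<Rightarrow> 'a \<Rightarrow> real" and p :: real
  assumes meas [measurable]: "\<And>i. eps i \<in> borel_measurable M"
    and stat: "strictly_stationary M eps"
    and mean0: "integral\<^sup>L M (eps 0) = 0"
    and p_gt: "p > 2"
    and Lp: "integrable M (\<lambda>\<omega>. \<bar>eps 0 \<omega>\<bar> powr p)"
    and C3_int: "\<And>k. k \<in> Vset 0 1 \<Longrightarrow>
        integrable M (\<lambda>\<omega>. \<bar>eps k \<omega> * real_cond_exp M (gen_sigma M eps (Vset 0 (supnormZ k))) (eps 0) \<omega>\<bar> powr (p / 2))"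
    and C3_sum: "(\<lambda>k. Lnorm M (p / 2)
          (\<lambda>\<omega>. eps k \<omega> * real_cond_exp M (gen_sigma M eps (Vset 0 (supnormZ k))) (eps 0) \<omega>))
        summable_on Vset 0 1"
begin

definition dep :: "(int, 'd) vec \<Rightarrow> real" where
  "dep k = Lnorm M (p / 2)
     (\<lambda>\<omega>. eps k \<omega> * real_cond_exp M (gen_sigma M eps (Vset 0 (supnormZ k))) (eps 0) \<omega>)"

definition psum :: "((int, 'd) vec \<Rightarrow> real) \<Rightarrow> (int, 'd) vec set \<Rightarrow> 'a \<Rightarrow> real" where
  "psum w \<Gamma> \<omega> = (\<Sum>i\<in>\<Gamma>. w i * eps i \<omega>)"

definition mom :: "((int, 'd) vec \<Rightarrow> real) \<Rightarrow> (int, 'd) vec set \<Rightarrow> real" where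
  "mom w \<Gamma> = (\<integral>\<omega>. \<bar>psum w \<Gamma> \<omega>\<bar> powr p \<partial>M)"

lemma psum_measurable [measurable]: "psum w \<Gamma> \<in> borel_measurable M"
  unfolding psum_def by measurable

lemma dep_nonneg: "dep k \<ge> 0"
  by (simp add: dep_def Lnorm_def)

lemma mom_nonneg: "mom w \<Gamma> \<ge> 0"
  by (simp add: mom_def)

text \<open>Equal image measures give equal integrals. The restriction to J makes the tuple of
  coordinates an element of the finite product space on which G lives.\<close>

lemma stationary_integral:
  fixes G :: "((int, 'd) vec \<Rightarrow> real) \<Rightarrow> real"
  assumes J: "finite J" and [measurable]: "G \<in> borel_measurable (PiM J (\<lambda>_. borel))"
  shows "(\<integral>\<omega>. G (\<lambda>i\<in>J. eps i \<omega>) \<partial>M) = (\<integral>\<omega>. G (\<lambda>i\<in>J. eps (i + k) \<omega>) \<partial>M)"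
    and "integrable M (\<lambda>\<omega>. G (\<lambda>i\<in>J. eps i \<omega>)) \<longleftrightarrow> integrable M (\<lambda>\<omega>. G (\<lambda>i\<in>J. eps (i + k) \<omega>))"
proof -
  have eq: "distr M (PiM J (\<lambda>_. borel)) (\<lambda>\<omega>. \<lambda>i\<in>J. eps i \<omega>)
      = distr M (PiM J (\<lambda>_. borel)) (\<lambda>\<omega>. \<lambda>i\<in>J. eps (i + k) \<omega>)"
    using stat J by (simp add: strictly_stationary_def)
  have [measurable]: "(\<lambda>\<omega>. \<lambda>i\<in>J. eps (f i) \<omega>) \<in> measurable M (PiM J (\<lambda>_. borel))" for f
    by (intro measurable_restrict) auto
  have "(\<integral>\<omega>. G (\<lambda>i\<in>J. eps (f i) \<omega>) \<partial>M) = integral\<^sup>L (distr M (PiM J (\<lambda>_. borel)) (\<lambda>\<omega>. \<lambda>i\<in>J. eps (f i) \<omega>)) G" for f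
    by (subst integral_distr) auto
  from this[of "\<lambda>i. i"] this[of "\<lambda>i. i + k"]
  show "(\<integral>\<omega>. G (\<lambda>i\<in>J. eps i \<omega>) \<partial>M) = (\<integral>\<omega>. G (\<lambda>i\<in>J. eps (i + k) \<omega>) \<partial>M)" using eq by simp
  have "integrable M (\<lambda>\<omega>. G (\<lambda>i\<in>J. eps (f i) \<omega>)) \<longleftrightarrow> integrable (distr M (PiM J (\<lambda>_. borel)) (\<lambda>\<omega>. \<lambda>i\<in>J. eps (f i) \<omega>)) G" for f
    by (subst integrable_distr_eq) auto
  from this[of "\<lambda>i. i"] this[of "\<lambda>i. i + k"]
  show "integrable M (\<lambda>\<omega>. G (\<lambda>i\<in>J. eps i \<omega>)) \<longleftrightarrow> integrable M (\<lambda>\<omega>. G (\<lambda>i\<in>J. eps (i + k) \<omega>))"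
    using eq by simp
qed

lemma eps_Lp: "integrable M (\<lambda>\<omega>. \<bar>eps i \<omega>\<bar> powr p)"
  using stationary_integral(2)[of "{0}" "\<lambda>f. \<bar>f 0\<bar> powr p" i] Lp by simp

lemma eps_Lp_integral: "(\<integral>\<omega>. \<bar>eps i \<omega>\<bar> powr p \<partial>M) = (\<integral>\<omega>. \<bar>eps 0 \<omega>\<bar> powr p \<partial>M)"
  using stationary_integral(1)[of "{0}" "\<lambda>f. \<bar>f 0\<bar> powr p" i] by simp

lemma eps_integrable: "integrable M (eps i)"
proof (rule Bochner_Integration.integrable_bound)
  show "integrable M (\<lambda>\<omega>. 1 + \<bar>eps i \<omega>\<bar> powr p)" using eps_Lp by auto
  have "\<bar>x\<bar> \<le> 1 + \<bar>x\<bar> powr p" for x :: real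
  proof (cases "\<bar>x\<bar> \<le> 1")
    case False
    then have "\<bar>x\<bar> powr 1 \<le> \<bar>x\<bar> powr p" using p_gt by (intro powr_mono) auto
    then show ?thesis using False by simp
  qed (simp add: add_increasing2)
  then show "AE \<omega> in M. norm (eps i \<omega>) \<le> norm (1 + \<bar>eps i \<omega>\<bar> powr p)" by auto
qed auto

lemma eps_mean: "(\<integral>\<omega>. eps i \<omega> \<partial>M) = 0"
  using stationary_integral(1)[of "{0}" "\<lambda>f. f 0" i] mean0 by simp

lemma eps_abs_integral: "(\<integral>\<omega>. \<bar>eps i \<omega>\<bar> \<partial>M) = (\<integral>\<omega>. \<bar>eps 0 \<omega>\<bar> \<partial>M)"
  using stationary_integral(1)[of "{0}" "\<lambda>f. \<bar>f 0\<bar>" i] by simp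

lemma shifted_sum_Lp:
  assumes "finite \<Gamma>"
  shows "integrable M (\<lambda>\<omega>. \<bar>\<Sum>i\<in>\<Gamma>. w i * eps (i + k) \<omega>\<bar> powr p)"
  using assms
proof (induction \<Gamma>)
  case (insert i \<Gamma>)
  have "integrable M (\<lambda>\<omega>. \<bar>w i * eps (i + k) \<omega>\<bar> powr p)"
    using eps_Lp[of "i + k"] by (simp add: abs_mult powr_mult)
  with insert show ?case using p_gt
    by (simp add: integrable_abs_powr_add)
qed simp

lemma psum_Lp:
  assumes "finite \<Gamma>"
  shows "integrable M (\<lambda>\<omega>. \<bar>psum w \<Gamma> \<omega>\<bar> powr p)"
  using shifted_sum_Lp[OF assms, of w 0] by (simp add: psum_def)

text \<open>The shift acts on the noise only and every weight stays with its index, so stationarity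
  returns the unshifted moment even for non-constant weights.\<close>

lemma shifted_sum_mom:
  assumes "finite \<Gamma>"
  shows "(\<integral>\<omega>. \<bar>\<Sum>i\<in>\<Gamma>. w i * eps (i + k) \<omega>\<bar> powr p \<partial>M) = mom w \<Gamma>"
proof -
  have "(\<lambda>f. \<bar>\<Sum>i\<in>\<Gamma>. w i * f i\<bar> powr p) \<in> borel_measurable (PiM \<Gamma> (\<lambda>_. borel))" by measurable
  from stationary_integral(1)[OF assms this, of k] show ?thesis
    by (simp add: mom_def psum_def)
qed

text \<open>Only finitely many coordinates occur under the integral, so stationarity of the finite-dimensional
  laws moves \<open>j\<close> to the origin before conditioning; no version of the conditional expectation has
  to be shifted.\<close>

lemma projective_increment_bound:
  assumes \<Gamma>: "finite \<Gamma>" "k \<notin> \<Gamma>" "insert k \<Gamma> \<subseteq> Vset j (supnormZ (j - k))"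
  shows "\<bar>\<integral>\<omega>. eps j \<omega> * (sgn (psum w (insert k \<Gamma>) \<omega>) * \<bar>psum w (insert k \<Gamma>) \<omega>\<bar> powr (p - 1)
      - sgn (psum w \<Gamma> \<omega>) * \<bar>psum w \<Gamma> \<omega>\<bar> powr (p - 1)) \<partial>M\<bar>
    \<le> (p - 1) * \<bar>w k\<bar> * dep (k - j) * (mom w \<Gamma> powr ((p - 2) / p) + mom w (insert k \<Gamma>) powr ((p - 2) / p))"
    (is "\<bar>?L\<bar> \<le> _")
proof -
  define \<phi> where "\<phi> = (\<lambda>x. sgn x * \<bar>x\<bar> powr (p - 1))"
  have [measurable]: "\<phi> \<in> borel_measurable borel" unfolding \<phi>_def by measurable
  define m where "m = supnormZ (k - j)"
  define F where "F = gen_sigma M eps (Vset 0 m)"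
  \<comment> \<open>The partial sums seen from j: the site i moves to i - j but keeps its weight
    \<open>w i\<close>.\<close>
  define T where "T = (\<lambda>\<Gamma> \<omega>. \<Sum>i\<in>\<Gamma>. w i * eps (i + - j) \<omega>)"
  define E where "E = real_cond_exp M F (eps 0)"
  have sub: "subalgebra M F" unfolding F_def by (rule subalgebra_gen_sigma) auto
  interpret F: finite_measure_subalgebra M F
    by unfold_locales (use sub in auto)
  have [measurable]: "E \<in> borel_measurable M" unfolding E_def by simp
  have mem: "i - j \<in> Vset 0 m" if "i \<in> insert k \<Gamma>" for i
    using \<Gamma>(3) that Vset_shift[of i j] by (auto simp: m_def supnormZ_minus_commute)
  \<comment> \<open>After the shift all sites lie in \<open>Vset 0 m\<close>, so these sums are
    known given F, the field that (C3) pairs with k - j.\<close>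
  have TF: "T \<Delta> \<in> borel_measurable F" if "\<Delta> \<subseteq> insert k \<Gamma>" for \<Delta>
    unfolding T_def F_def using that mem
    by (intro borel_measurable_sum borel_measurable_times measurable_gen_sigma borel_measurable_const) auto
  have TM [measurable]: "T \<Delta> \<in> borel_measurable M" for \<Delta> unfolding T_def by measurable
  have Tp: "integrable M (\<lambda>\<omega>. \<bar>T \<Delta> \<omega>\<bar> powr p)" if "finite \<Delta>" for \<Delta>
    unfolding T_def using shifted_sum_Lp[OF that] .
  have Tmom: "(\<integral>\<omega>. \<bar>T \<Delta> \<omega>\<bar> powr p \<partial>M) = mom w \<Delta>" if "finite \<Delta>" for \<Delta>
    unfolding T_def using shifted_sum_mom[OF that] .
  have Tins: "T (insert k \<Gamma>) \<omega> - T \<Gamma> \<omega> = w k * eps (k - j) \<omega>" for \<omega>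
    using \<Gamma> by (simp add: T_def)
  define J where "J = insert j (insert k \<Gamma>)"
  have J: "finite J" using \<Gamma> by (simp add: J_def)
  define G where "G = (\<lambda>f. f j * (\<phi> (\<Sum>i\<in>insert k \<Gamma>. w i * f i) - \<phi> (\<Sum>i\<in>\<Gamma>. w i * f i)))"
  have sumJ: "(\<lambda>f. \<Sum>i\<in>\<Delta>. w i * f i) \<in> borel_measurable (PiM J (\<lambda>_. borel))" if "\<Delta> \<subseteq> J" for \<Delta>
    using that by (intro borel_measurable_sum borel_measurable_times borel_measurable_const measurable_component_singleton) auto
  have [measurable]: "G \<in> borel_measurable (PiM J (\<lambda>_. borel))"
    unfolding G_def
    by (intro borel_measurable_times borel_measurable_diff measurable_component_singleton
        measurable_compose[OF _ \<open>\<phi> \<in> borel_measurable borel\<close>] sumJ) (auto simp: J_def)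
  have restr: "(\<Sum>i\<in>\<Delta>. w i * (\<lambda>i\<in>J. f i) i) = (\<Sum>i\<in>\<Delta>. w i * f i)" if "\<Delta> \<subseteq> J" for \<Delta> f
    using that by (intro sum.cong) auto
  define D where "D = (\<lambda>\<omega>. \<phi> (T (insert k \<Gamma>) \<omega>) - \<phi> (T \<Gamma> \<omega>))"
  have [measurable]: "D \<in> borel_measurable M" unfolding D_def by measurable
  have DF: "D \<in> borel_measurable F"
    unfolding D_def using TF[of \<Gamma>] TF[of "insert k \<Gamma>"]
    by (intro borel_measurable_diff measurable_compose[OF _ \<open>\<phi> \<in> borel_measurable borel\<close>]) auto
  have "?L = (\<integral>\<omega>. G (\<lambda>i\<in>J. eps i \<omega>) \<partial>M)"
    unfolding G_def using restr[of \<Gamma>] restr[of "insert k \<Gamma>"]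
    by (simp add: psum_def \<phi>_def J_def subset_insertI2 del: sum.insert)
  also have "\<dots> = (\<integral>\<omega>. G (\<lambda>i\<in>J. eps (i + - j) \<omega>) \<partial>M)"
    using J by (rule stationary_integral) measurable
  also have "\<dots> = (\<integral>\<omega>. D \<omega> * eps 0 \<omega> \<partial>M)"
    unfolding G_def D_def T_def using restr[of \<Gamma>] restr[of "insert k \<Gamma>"]
    by (simp add: J_def subset_insertI2 mult.commute del: sum.insert)
  \<comment> \<open>Since D is measurable for F, \<open>eps 0\<close> may be replaced by its
    conditional expectation.\<close>
  also have "\<dots> = (\<integral>\<omega>. D \<omega> * E \<omega> \<partial>M)"
    unfolding E_def
  proof (rule F.real_cond_exp_intg(2)[symmetric])
    have "integrable M (\<lambda>\<omega>. \<phi> (T (insert k \<Gamma>) \<omega>) * eps 0 \<omega> - \<phi> (T \<Gamma> \<omega>) * eps 0 \<omega>)"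
      unfolding \<phi>_def using p_gt \<Gamma>
      by (intro Bochner_Integration.integrable_diff integrable_signed_powr_mult Tp eps_Lp) auto
    then show "integrable M (\<lambda>\<omega>. D \<omega> * eps 0 \<omega>)" by (simp add: D_def left_diff_distrib)
  qed (use DF in auto)
  finally have L: "?L = (\<integral>\<omega>. D \<omega> * E \<omega> \<partial>M)" .
  \<comment> \<open>The mean value bound for D contains the factor \<open>eps (k - j)\<close>;
    multiplied by E it is exactly the product whose norm (C3) controls.\<close>
  define U where "U = (\<lambda>\<omega>. eps (k - j) \<omega> * E \<omega>)"
  have [measurable]: "U \<in> borel_measurable M" unfolding U_def by measurable
  have kV: "k - j \<in> Vset 0 1"
  proof -
    have "lex_less (k - j) 0" using mem[of k] by (auto simp: Vset_def)
    then show ?thesis using supnormZ_ge_one[of "k - j" 0] by (simp add: Vset_def)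
  qed
  have Up: "integrable M (\<lambda>\<omega>. \<bar>U \<omega>\<bar> powr (p / 2))"
    using C3_int[OF kV] by (simp add: U_def E_def F_def m_def)
  have Udep: "(\<integral>\<omega>. \<bar>U \<omega>\<bar> powr (p / 2) \<partial>M) powr (2 / p) = dep (k - j)"
    by (simp add: dep_def Lnorm_def U_def E_def F_def m_def)
  note H = Holder_mixed_powr[OF p_gt \<open>U \<in> borel_measurable M\<close> TM Up Tp, unfolded Udep]
  have fin: "finite (insert k \<Gamma>)" using \<Gamma> by simp
  have ptw: "\<bar>D \<omega> * E \<omega>\<bar> \<le> (p - 1) * \<bar>w k\<bar> * (\<bar>U \<omega>\<bar> * \<bar>T \<Gamma> \<omega>\<bar> powr (p - 2) + \<bar>U \<omega>\<bar> * \<bar>T (insert k \<Gamma>) \<omega>\<bar> powr (p - 2))" for \<omega>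
  proof -
    have "\<bar>D \<omega>\<bar> \<le> (p - 1) * \<bar>w k * eps (k - j) \<omega>\<bar> * (\<bar>T \<Gamma> \<omega>\<bar> powr (p - 2) + \<bar>T (insert k \<Gamma>) \<omega>\<bar> powr (p - 2))"
      unfolding D_def \<phi>_def using signed_powr_diff_bound_sum[OF p_gt, of "T (insert k \<Gamma>) \<omega>" "T \<Gamma> \<omega>"] Tins by simp
    then have "\<bar>D \<omega>\<bar> * \<bar>E \<omega>\<bar> \<le> (p - 1) * \<bar>w k * eps (k - j) \<omega>\<bar> * (\<bar>T \<Gamma> \<omega>\<bar> powr (p - 2) + \<bar>T (insert k \<Gamma>) \<omega>\<bar> powr (p - 2)) * \<bar>E \<omega>\<bar>"
      by (intro mult_right_mono) auto
    then show ?thesis by (simp add: U_def abs_mult algebra_simps)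
  qed
  have "\<bar>?L\<bar> \<le> (\<integral>\<omega>. (p - 1) * \<bar>w k\<bar> * (\<bar>U \<omega>\<bar> * \<bar>T \<Gamma> \<omega>\<bar> powr (p - 2) + \<bar>U \<omega>\<bar> * \<bar>T (insert k \<Gamma>) \<omega>\<bar> powr (p - 2)) \<partial>M)"
    unfolding L
  proof (rule order.trans[OF integral_abs_bound integral_mono])
    show "integrable M (\<lambda>\<omega>. (p - 1) * \<bar>w k\<bar> * (\<bar>U \<omega>\<bar> * \<bar>T \<Gamma> \<omega>\<bar> powr (p - 2) + \<bar>U \<omega>\<bar> * \<bar>T (insert k \<Gamma>) \<omega>\<bar> powr (p - 2)))"
      using H(1)[OF \<Gamma>(1)] H(1)[OF fin] by auto
    then show "integrable M (\<lambda>\<omega>. \<bar>D \<omega> * E \<omega>\<bar>)"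
      by (rule Bochner_Integration.integrable_bound) (use ptw in \<open>auto intro: order.trans[OF _ abs_ge_self]\<close>)
  qed (use ptw in auto)
  also have "\<dots> = (p - 1) * \<bar>w k\<bar> * ((\<integral>\<omega>. \<bar>U \<omega>\<bar> * \<bar>T \<Gamma> \<omega>\<bar> powr (p - 2) \<partial>M) + (\<integral>\<omega>. \<bar>U \<omega>\<bar> * \<bar>T (insert k \<Gamma>) \<omega>\<bar> powr (p - 2) \<partial>M))"
    using H(1)[OF \<Gamma>(1)] H(1)[OF fin] by simp
  also have "\<dots> \<le> (p - 1) * \<bar>w k\<bar> * (dep (k - j) * mom w \<Gamma> powr ((p - 2) / p) + dep (k - j) * mom w (insert k \<Gamma>) powr ((p - 2) / p))"
    using H(2)[OF \<Gamma>(1)] H(2)[OF fin] Tmom[OF \<Gamma>(1)] Tmom[OF fin] p_gt by (intro mult_left_mono add_mono) auto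
  finally show ?thesis by (simp add: algebra_simps)
qed

text \<open>The points of \<Gamma> are removed one at a time, so the integral telescopes into the
  increments bounded before and ends at the empty sum, which is 0. X has to bound the moments of all
  subsets because each stage of the removal contributes one. Every increment involves two moments,
  hence the factor 2.\<close>

lemma projective_bound:
  assumes "finite \<Gamma>" "\<Gamma> \<subseteq> Vset j 1" "\<And>i. \<bar>w i\<bar> \<le> W"
    and "\<And>\<Delta>. \<Delta> \<subseteq> \<Gamma> \<Longrightarrow> mom w \<Delta> powr ((p - 2) / p) \<le> X"
  shows "\<bar>\<integral>\<omega>. eps j \<omega> * (sgn (psum w \<Gamma> \<omega>) * \<bar>psum w \<Gamma> \<omega>\<bar> powr (p - 1)) \<partial>M\<bar>
    \<le> 2 * (p - 1) * W * X * (\<Sum>k\<in>\<Gamma>. dep (k - j))"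
  using assms
proof (induction "card \<Gamma>" arbitrary: \<Gamma>)
  case 0
  then show ?case by (simp add: psum_def)
next
  case (Suc n)
  define \<phi> where "\<phi> = (\<lambda>x. sgn x * \<bar>x\<bar> powr (p - 1))"
  have "\<Gamma> \<noteq> {}" using Suc by auto
  \<comment> \<open>Removing the point closest to \<open>j\<close> keeps the rest measurable for the field at that distance.\<close>
  then obtain k where k: "k \<in> \<Gamma>" "\<And>i. i \<in> \<Gamma> \<Longrightarrow> supnormZ (j - k) \<le> supnormZ (j - i)"
    using ex_min_if_finite[of "(\<lambda>i. supnormZ (j - i)) ` \<Gamma>"] \<open>finite \<Gamma>\<close> by (force simp: not_less)
  define \<Delta> where "\<Delta> = \<Gamma> - {k}"
  have \<Delta>: "finite \<Delta>" "k \<notin> \<Delta>" "\<Gamma> = insert k \<Delta>" "\<Delta> \<subseteq> \<Gamma>" "card \<Delta> = n"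
    using k Suc by (auto simp: \<Delta>_def)
  have V: "insert k \<Delta> \<subseteq> Vset j (supnormZ (j - k))"
    using k(2) Suc(4) \<Delta>(3) by (auto simp: Vset_def)
  have "W \<ge> 0" using order.trans[OF abs_ge_zero Suc(5)] by blast
  have "X \<ge> 0" using order.trans[OF powr_ge_zero Suc(6)] by blast
  have int: "integrable M (\<lambda>\<omega>. eps j \<omega> * \<phi> (psum w A \<omega>))" if "finite A" for A
    unfolding \<phi>_def using integrable_signed_powr_mult[of p "psum w A" M "eps j"] that psum_Lp eps_Lp p_gt
    by (simp add: mult_ac)
  have "(\<integral>\<omega>. eps j \<omega> * \<phi> (psum w \<Gamma> \<omega>) \<partial>M)
      = (\<integral>\<omega>. eps j \<omega> * (\<phi> (psum w \<Gamma> \<omega>) - \<phi> (psum w \<Delta> \<omega>)) \<partial>M) + (\<integral>\<omega>. eps j \<omega> * \<phi> (psum w \<Delta> \<omega>) \<partial>M)"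
    using int[OF \<Delta>(1)] int[OF Suc(3)] by (simp add: right_diff_distrib)
  also have "\<bar>\<dots>\<bar> \<le> (p - 1) * \<bar>w k\<bar> * dep (k - j) * (mom w \<Delta> powr ((p - 2) / p) + mom w \<Gamma> powr ((p - 2) / p))
      + 2 * (p - 1) * W * X * (\<Sum>k\<in>\<Delta>. dep (k - j))"
  proof (rule order.trans[OF abs_triangle_ineq add_mono])
    show "\<bar>\<integral>\<omega>. eps j \<omega> * (\<phi> (psum w \<Gamma> \<omega>) - \<phi> (psum w \<Delta> \<omega>)) \<partial>M\<bar>
        \<le> (p - 1) * \<bar>w k\<bar> * dep (k - j) * (mom w \<Delta> powr ((p - 2) / p) + mom w \<Gamma> powr ((p - 2) / p))"
      using projective_increment_bound[OF \<Delta>(1,2) V, of w] unfolding \<phi>_def \<Delta>(3)[symmetric] .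
    have "mom w \<Delta>' powr ((p - 2) / p) \<le> X" if "\<Delta>' \<subseteq> \<Delta>" for \<Delta>'
      using that \<Delta>(4) by (intro Suc(6)) auto
    moreover have "\<Delta> \<subseteq> Vset j 1" using \<Delta>(4) Suc(4) by auto
    ultimately show "\<bar>\<integral>\<omega>. eps j \<omega> * \<phi> (psum w \<Delta> \<omega>) \<partial>M\<bar> \<le> 2 * (p - 1) * W * X * (\<Sum>k\<in>\<Delta>. dep (k - j))"
      unfolding \<phi>_def using Suc(1)[OF \<Delta>(5)[symmetric] \<Delta>(1)] Suc(5) by blast
  qed
  also have "(p - 1) * \<bar>w k\<bar> * dep (k - j) * (mom w \<Delta> powr ((p - 2) / p) + mom w \<Gamma> powr ((p - 2) / p))
     \<le> (p - 1) * W * dep (k - j) * (X + X)"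
    using p_gt dep_nonneg[of "k - j"] Suc(5) Suc(6)[OF \<Delta>(4)] Suc(6)[of \<Gamma>] \<open>W \<ge> 0\<close> \<open>X \<ge> 0\<close>
    by (intro mult_mono add_mono mult_nonneg_nonneg add_nonneg_nonneg) auto
  also have "(p - 1) * W * dep (k - j) * (X + X) + 2 * (p - 1) * W * X * (\<Sum>k\<in>\<Delta>. dep (k - j))
    = 2 * (p - 1) * W * X * (\<Sum>k\<in>\<Gamma>. dep (k - j))"
    using \<Delta> by (simp add: algebra_simps)
  finally show ?case by (simp add: \<phi>_def)
qed

text \<open>The second summand is the squared L^p norm of \<open>eps 0\<close>, the diagonal term
  missing from the series over the strict past.\<close>

definition dep_total :: real where
  "dep_total = infsum dep (Vset 0 1) + (\<integral>\<omega>. \<bar>eps 0 \<omega>\<bar> powr p \<partial>M) powr (2 / p)"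

lemma sum_dep_le:
  assumes "finite \<Gamma>" "\<Gamma> \<subseteq> Vset j 1"
  shows "(\<Sum>k\<in>\<Gamma>. dep (k - j)) \<le> infsum dep (Vset 0 1)"
proof -
  have "(\<Sum>k\<in>\<Gamma>. dep (k - j)) = sum dep ((\<lambda>k. k - j) ` \<Gamma>)"
    by (subst sum.reindex) (auto simp: inj_on_def)
  also have "\<dots> \<le> infsum dep (Vset 0 1)"
    using assms C3_sum Vset_shift dep_nonneg
    by (intro finite_sum_le_infsum) (auto simp: dep_def[abs_def])
  finally show ?thesis .
qed

lemma dep_total_nonneg: "dep_total \<ge> 0"
  unfolding dep_total_def by (intro add_nonneg_nonneg infsum_nonneg dep_nonneg) auto

text \<open>The lexicographically greatest point j is split off by Taylor expansion. The rest lies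
  in the past of j, so the dependence coefficients control the linear term; Hoelder's inequality
  controls the quadratic ones. Every point costs the same amount, which produces the
  cardinality.\<close>

lemma mom_le_card:
  assumes "finite \<Gamma>" "\<And>i. \<bar>w i\<bar> \<le> W"
    and "\<And>\<Delta>. \<Delta> \<subseteq> \<Gamma> \<Longrightarrow> mom w \<Delta> powr ((p - 2) / p) \<le> X"
  shows "mom w \<Gamma> \<le> 2 * p * (p - 1) * W\<^sup>2 * dep_total * X * card \<Gamma>"
  using assms
proof (induction "card \<Gamma>" arbitrary: \<Gamma>)
  case 0
  then show ?case by (simp add: mom_def psum_def)
next
  case (Suc n)
  then have "\<Gamma> \<noteq> {}" by auto
  with \<open>finite \<Gamma>\<close> obtain j where j: "j \<in> \<Gamma>" "\<Gamma> - {j} \<subseteq> Vset j 1" by (rule finite_lex_greatest)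
  define \<Delta> where "\<Delta> = \<Gamma> - {j}"
  have \<Delta>: "finite \<Delta>" "j \<notin> \<Delta>" "\<Gamma> = insert j \<Delta>" "\<Delta> \<subseteq> \<Gamma>" "card \<Delta> = n" "\<Delta> \<subseteq> Vset j 1"
    using j Suc by (auto simp: \<Delta>_def)
  have W0: "W \<ge> 0" using order.trans[OF abs_ge_zero Suc(4)] by blast
  have X0: "X \<ge> 0" using order.trans[OF powr_ge_zero Suc(5)] by blast
  define u where "u = psum w \<Delta>"
  define v where "v = (\<lambda>\<omega>. w j * eps j \<omega>)"
  define s where "s = (\<integral>\<omega>. \<bar>eps 0 \<omega>\<bar> powr p \<partial>M) powr (2 / p)"
  have uv: "psum w \<Gamma> \<omega> = u \<omega> + v \<omega>" for \<omega>
    using \<Delta> by (simp add: psum_def u_def v_def)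
  have [measurable]: "u \<in> borel_measurable M" "v \<in> borel_measurable M"
    by (auto simp: u_def v_def)
  have up: "integrable M (\<lambda>\<omega>. \<bar>u \<omega>\<bar> powr p)" unfolding u_def using psum_Lp[OF \<Delta>(1)] .
  have uvp: "integrable M (\<lambda>\<omega>. \<bar>u \<omega> + v \<omega>\<bar> powr p)" using psum_Lp[OF Suc(3), of w] by (simp add: uv)
  \<comment> \<open>Lets the square of v enter Hoelder's inequality at exponent p/2 through the p-th
    moment of v.\<close>
  have sq: "\<bar>(x::real)\<^sup>2\<bar> powr (p / 2) = \<bar>x\<bar> powr p" for x
  proof -
    have "\<bar>x\<^sup>2\<bar> = \<bar>x\<bar> powr 2" by simp
    then show ?thesis by (simp only: powr_powr) simp
  qed
  have vp: "integrable M (\<lambda>\<omega>. \<bar>v \<omega>\<bar> powr p)"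
    using eps_Lp[of j] by (simp add: v_def abs_mult powr_mult)
  then have vp2: "integrable M (\<lambda>\<omega>. \<bar>(v \<omega>)\<^sup>2\<bar> powr (p / 2))" by (simp only: sq)
  have "(\<integral>\<omega>. \<bar>(v \<omega>)\<^sup>2\<bar> powr (p / 2) \<partial>M) powr (2 / p) = (\<bar>w j\<bar> powr p * (\<integral>\<omega>. \<bar>eps 0 \<omega>\<bar> powr p \<partial>M)) powr (2 / p)"
    unfolding sq using eps_Lp_integral[of j] by (simp add: v_def abs_mult powr_mult)
  also have "\<dots> = (w j)\<^sup>2 * s"
    using p_gt by (simp add: powr_mult powr_powr s_def)
  also have "\<dots> \<le> W\<^sup>2 * s"
    using Suc(4)[of j] W0 by (intro mult_right_mono) (auto simp: s_def abs_le_square_iff[symmetric])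
  finally have vs: "(\<integral>\<omega>. \<bar>(v \<omega>)\<^sup>2\<bar> powr (p / 2) \<partial>M) powr (2 / p) \<le> W\<^sup>2 * s" .
  have Hu: "integrable M (\<lambda>\<omega>. (v \<omega>)\<^sup>2 * \<bar>u \<omega>\<bar> powr (p - 2))"
      "(\<integral>\<omega>. (v \<omega>)\<^sup>2 * \<bar>u \<omega>\<bar> powr (p - 2) \<partial>M) \<le> W\<^sup>2 * s * X"
    using Holder_mixed_powr[OF p_gt, of "\<lambda>\<omega>. (v \<omega>)\<^sup>2" M u] vp2 up
      mult_mono[OF vs Suc(5)[OF \<Delta>(4)]] by (auto simp: mom_def u_def s_def)
  have Huv: "integrable M (\<lambda>\<omega>. (v \<omega>)\<^sup>2 * \<bar>u \<omega> + v \<omega>\<bar> powr (p - 2))"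
      "(\<integral>\<omega>. (v \<omega>)\<^sup>2 * \<bar>u \<omega> + v \<omega>\<bar> powr (p - 2) \<partial>M) \<le> W\<^sup>2 * s * X"
    using Holder_mixed_powr[OF p_gt, of "\<lambda>\<omega>. (v \<omega>)\<^sup>2" M "\<lambda>\<omega>. u \<omega> + v \<omega>"] vp2 uvp
      mult_mono[OF vs Suc(5)[of \<Gamma>]] by (auto simp: mom_def s_def uv)
  define \<phi> where "\<phi> = (\<lambda>x. sgn x * \<bar>x\<bar> powr (p - 1))"
  have i\<phi>: "integrable M (\<lambda>\<omega>. \<phi> (u \<omega>) * v \<omega>)"
    unfolding \<phi>_def using p_gt up vp by (intro integrable_signed_powr_mult) auto
  have "(\<integral>\<omega>. \<phi> (u \<omega>) * v \<omega> \<partial>M) = w j * (\<integral>\<omega>. eps j \<omega> * \<phi> (u \<omega>) \<partial>M)"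
    by (subst integral_mult_right_zero[symmetric]) (simp add: v_def mult_ac)
  also have "\<dots> \<le> \<bar>w j\<bar> * \<bar>\<integral>\<omega>. eps j \<omega> * \<phi> (u \<omega>) \<partial>M\<bar>"
    by (simp flip: abs_mult)
  also have "\<dots> \<le> W * (2 * (p - 1) * W * X * (\<Sum>k\<in>\<Delta>. dep (k - j)))"
  proof (intro mult_mono)
    have "mom w \<Delta>' powr ((p - 2) / p) \<le> X" if "\<Delta>' \<subseteq> \<Delta>" for \<Delta>'
      using that \<Delta>(4) by (intro Suc(5)) auto
    then show "\<bar>\<integral>\<omega>. eps j \<omega> * \<phi> (u \<omega>) \<partial>M\<bar> \<le> 2 * (p - 1) * W * X * (\<Sum>k\<in>\<Delta>. dep (k - j))"
      unfolding \<phi>_def u_def by (rule projective_bound[OF \<Delta>(1,6) Suc(4)])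
  qed (use Suc(4) W0 in auto)
  also have "\<dots> \<le> W * (2 * (p - 1) * W * X * infsum dep (Vset 0 1))"
    using W0 X0 p_gt sum_dep_le[OF \<Delta>(1,6)] by (intro mult_left_mono) auto
  finally have lin: "(\<integral>\<omega>. \<phi> (u \<omega>) * v \<omega> \<partial>M) \<le> 2 * (p - 1) * W\<^sup>2 * X * infsum dep (Vset 0 1)"
    by (simp add: power2_eq_square mult_ac)
  have taylor: "\<bar>u \<omega> + v \<omega>\<bar> powr p \<le> \<bar>u \<omega>\<bar> powr p + p * (\<phi> (u \<omega>) * v \<omega>)
      + p * (p - 1) * ((v \<omega>)\<^sup>2 * \<bar>u \<omega>\<bar> powr (p - 2) + (v \<omega>)\<^sup>2 * \<bar>u \<omega> + v \<omega>\<bar> powr (p - 2))" for \<omega>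
    using abs_powr_taylor_bound[OF p_gt, of "u \<omega>" "v \<omega>"] by (simp add: \<phi>_def algebra_simps)
  have "mom w \<Gamma> \<le> (\<integral>\<omega>. \<bar>u \<omega>\<bar> powr p + p * (\<phi> (u \<omega>) * v \<omega>)
      + p * (p - 1) * ((v \<omega>)\<^sup>2 * \<bar>u \<omega>\<bar> powr (p - 2) + (v \<omega>)\<^sup>2 * \<bar>u \<omega> + v \<omega>\<bar> powr (p - 2)) \<partial>M)"
    unfolding mom_def uv using uvp up i\<phi> Hu(1) Huv(1)
    by (intro integral_mono taylor) auto
  also have "\<dots> = mom w \<Delta> + p * (\<integral>\<omega>. \<phi> (u \<omega>) * v \<omega> \<partial>M)
      + p * (p - 1) * ((\<integral>\<omega>. (v \<omega>)\<^sup>2 * \<bar>u \<omega>\<bar> powr (p - 2) \<partial>M) + (\<integral>\<omega>. (v \<omega>)\<^sup>2 * \<bar>u \<omega> + v \<omega>\<bar> powr (p - 2) \<partial>M))"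
    using up i\<phi> Hu(1) Huv(1) by (simp add: mom_def u_def)
  also have "\<dots> \<le> 2 * p * (p - 1) * W\<^sup>2 * dep_total * X * card \<Delta>
      + p * (2 * (p - 1) * W\<^sup>2 * X * infsum dep (Vset 0 1)) + p * (p - 1) * (W\<^sup>2 * s * X + W\<^sup>2 * s * X)"
    using Suc.hyps(1)[of \<Delta>] Suc.prems \<Delta> lin Hu(2) Huv(2) p_gt
    by (intro add_mono mult_left_mono) auto
  \<comment> \<open>The linear and the quadratic contribution carry the same constant, which is why
    \<open>dep_total\<close> collects them in a plain sum.\<close>
  also have "\<dots> = 2 * p * (p - 1) * W\<^sup>2 * dep_total * X * card \<Gamma>"
    using \<Delta> by (simp add: dep_total_def s_def algebra_simps)
  finally show ?case .
qed

text \<open>Self-bounding: the largest moment \<open>Mx\<close> over all subsets of \<open>B\<close> satisfies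
  \<open>Mx \<le> Q Mx\<^bsup>(p - 2)/p\<^esup>\<close>, so no maximal inequality for partial sums is needed.\<close>

lemma moment_inequality:
  assumes fin: "finite B" and W: "\<And>i. \<bar>w i\<bar> \<le> W"
  shows "mom w B \<le> (2 * p * (p - 1) * W\<^sup>2 * dep_total * card B) powr (p / 2)"
proof -
  define Q where "Q = 2 * p * (p - 1) * W\<^sup>2 * dep_total * card B"
  define Mx where "Mx = Max (mom w ` Pow B)"
  have "Mx \<in> mom w ` Pow B" unfolding Mx_def using fin by (intro Max_in) auto
  then obtain \<Gamma> where \<Gamma>: "\<Gamma> \<subseteq> B" "Mx = mom w \<Gamma>" by auto
  have le: "mom w \<Delta> \<le> Mx" if "\<Delta> \<subseteq> B" for \<Delta>
    unfolding Mx_def using fin that by (intro Max_ge) auto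
  \<comment> \<open>Subsets of the maximiser \<Gamma> are subsets of B, so their moments are at most
    Mx and X may be taken as \<open>Mx powr ((p - 2) / p)\<close>.\<close>
  have "Mx \<le> 2 * p * (p - 1) * W\<^sup>2 * dep_total * Mx powr ((p - 2) / p) * card \<Gamma>"
    unfolding \<Gamma>(2) using W \<Gamma> fin finite_subset[OF \<Gamma>(1)] le p_gt mom_nonneg
    by (intro mom_le_card powr_mono2) (auto simp flip: \<Gamma>(2))
  also have "\<dots> \<le> 2 * p * (p - 1) * W\<^sup>2 * dep_total * Mx powr ((p - 2) / p) * card B"
    using p_gt dep_total_nonneg card_mono[OF fin \<Gamma>(1)] by (intro mult_left_mono) auto
  finally have *: "Mx \<le> Q * Mx powr ((p - 2) / p)" by (simp add: Q_def mult_ac)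
  have Q0: "Q \<ge> 0" using p_gt dep_total_nonneg by (simp add: Q_def)
  have "Mx \<le> Q powr (p / 2)"
  proof (cases "Mx > 0")
    case True
    have "Mx powr (2 / p) * Mx powr ((p - 2) / p) = Mx powr 1"
      using p_gt by (simp flip: powr_add add: add_divide_distrib[symmetric])
    then have "Mx powr (2 / p) * Mx powr ((p - 2) / p) \<le> Q * Mx powr ((p - 2) / p)"
      using * True by simp
    then have "Mx powr (2 / p) \<le> Q" using True by simp
    then have "(Mx powr (2 / p)) powr (p / 2) \<le> Q powr (p / 2)" using p_gt by (intro powr_mono2) auto
    then show ?thesis using True p_gt by (simp add: powr_powr)
  next
    case False
    then show ?thesis by (intro order.trans[OF _ powr_ge_zero]) auto
  qed
  then show ?thesis using le[of B] by (simp add: Q_def)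
qed

end

subsection \<open>Dyadic decomposition of boxes\<close>

text \<open>A pair (j, m) stands for scale and position; for each j the intervals of length 2^j tile
  [0, 2^r).\<close>

definition dyad :: "nat \<Rightarrow> (nat \<times> nat) set" where
  "dyad r = (SIGMA j:{..r}. {..<2 ^ (r - j)})"

definition dyadic_interval :: "nat \<times> nat \<Rightarrow> int set" where
  "dyadic_interval q = {int (snd q) * 2 ^ fst q ..< (int (snd q) + 1) * 2 ^ fst q}"

lemma finite_dyad [simp]: "finite (dyad r)"
  by (simp add: dyad_def)

text \<open>Each binary digit 1 of v contributes one interval, so at most one per scale is used, and
  there are r + 1 scales. Scale r occurs only for v = 2^r.\<close>

lemma dyadic_prefix:
  assumes v: "v \<le> 2 ^ r"
  shows "\<exists>\<sigma>. (\<Sum>q\<in>dyad r. \<bar>\<sigma> q\<bar>) \<le> real r + 1 \<and>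
    (\<forall>t. of_bool (0 \<le> t \<and> t < int v) = (\<Sum>q\<in>dyad r. \<sigma> q * of_bool (t \<in> dyadic_interval q) :: real))"
proof -
  \<comment> \<open>the binary expansion of \<open>v\<close>\<close>
  define \<sigma> :: "nat \<times> nat \<Rightarrow> real" where
    "\<sigma> = (\<lambda>q. of_bool (odd (v div 2 ^ fst q) \<and> Suc (snd q) = v div 2 ^ fst q))"
  have sum_eq: "(\<Sum>q\<in>dyad r. \<sigma> q * f q) = (\<Sum>j\<le>r. of_bool (odd (v div 2 ^ j)) * f (j, v div 2 ^ j - 1))" for f
  proof -
    have "(\<Sum>q\<in>dyad r. \<sigma> q * f q) = (\<Sum>j\<le>r. \<Sum>m<2 ^ (r - j). \<sigma> (j, m) * f (j, m))"
      unfolding dyad_def by (subst sum.Sigma) auto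
    also have "\<dots> = (\<Sum>j\<le>r. of_bool (odd (v div 2 ^ j)) * f (j, v div 2 ^ j - 1))"
    proof (rule sum.cong[OF refl])
      fix j assume "j \<in> {..r}"
      then have "(2::nat) ^ r = 2 ^ (r - j) * 2 ^ j" by (simp flip: power_add)
      then have "v div 2 ^ j \<le> 2 ^ (r - j)" using v div_le_mono[of v "2 ^ r" "2 ^ j"] by simp
      \<comment> \<open>An odd quotient is nonzero, so the truncated \<open>v div 2 ^ j - 1\<close>
        is a true predecessor and a legal position.\<close>
      have "(\<Sum>m<2 ^ (r - j). \<sigma> (j, m) * f (j, m))
        = (\<Sum>m<2 ^ (r - j). if m = v div 2 ^ j - 1 then of_bool (odd (v div 2 ^ j)) * f (j, m) else 0)"
        by (rule sum.cong) (auto simp: \<sigma>_def of_bool_def elim: oddE)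
      also have "\<dots> = of_bool (odd (v div 2 ^ j)) * f (j, v div 2 ^ j - 1)"
        using \<open>v div 2 ^ j \<le> 2 ^ (r - j)\<close> by (auto simp: sum.delta' not_less) (metis One_nat_def diff_less even_zero leD less_le_trans neq0_conv zero_less_one)
      finally show "(\<Sum>m<2 ^ (r - j). \<sigma> (j, m) * f (j, m)) = of_bool (odd (v div 2 ^ j)) * f (j, v div 2 ^ j - 1)" .
    qed
    finally show ?thesis .
  qed
  have "(\<Sum>q\<in>dyad r. \<bar>\<sigma> q\<bar>) = (\<Sum>q\<in>dyad r. \<sigma> q * 1)"
    by (rule sum.cong) (auto simp: \<sigma>_def)
  also have "\<dots> \<le> (\<Sum>j\<le>r. 1)" unfolding sum_eq by (rule sum_mono) auto
  finally have "(\<Sum>q\<in>dyad r. \<bar>\<sigma> q\<bar>) \<le> real r + 1" by simp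
  moreover have "of_bool (0 \<le> t \<and> t < int v) = (\<Sum>q\<in>dyad r. \<sigma> q * of_bool (t \<in> dyadic_interval q) :: real)" for t
  proof -
    \<comment> \<open>Indicator of the prefix that ends at v with its j lowest binary digits
      cleared. Passing from j to j + 1 drops exactly the block of digit j, so the sum telescopes
      from [0, v) to the empty set.\<close>
    define F :: "nat \<Rightarrow> real" where "F j = of_bool (0 \<le> t \<and> t < 2 ^ j * int (v div 2 ^ j))" for j
    have "of_bool (odd (v div 2 ^ j)) * of_bool (t \<in> dyadic_interval (j, v div 2 ^ j - 1)) = F j - F (Suc j)" for j
    proof -
      define a where "a = v div 2 ^ j"
      have a2: "v div 2 ^ Suc j = a div 2" by (simp only: a_def power_Suc2 div_mult2_eq)
      show ?thesis
      proof (cases "even a")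
        case True
        then obtain b where "a = 2 * b" by (elim evenE)
        then show ?thesis using a2 by (simp add: F_def mult_ac flip: a_def)
      next
        case False
        then obtain b where b: "a = 2 * b + 1" by (elim oddE)
        define x y where "x = 2 ^ j * int b" and "y = (2::int) ^ j"
        have "x \<ge> 0" "y > 0" by (auto simp: x_def y_def)
        moreover have "t < 2 ^ j * int a \<longleftrightarrow> t < 2 * x + y"
          "t < 2 ^ Suc j * int (a div 2) \<longleftrightarrow> t < 2 * x"
          "t \<in> dyadic_interval (j, a - 1) \<longleftrightarrow> 2 * x \<le> t \<and> t < 2 * x + y"
          by (auto simp: b dyadic_interval_def x_def y_def algebra_simps)
        ultimately show ?thesis using False unfolding F_def a2 a_def[symmetric]
          by (auto simp: of_bool_def)
      qed
    qed
    then have "(\<Sum>q\<in>dyad r. \<sigma> q * of_bool (t \<in> dyadic_interval q)) = (\<Sum>j\<le>r. F j - F (Suc j))"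
      unfolding sum_eq by simp
    also have "\<dots> = F 0 - F (Suc r)" by (rule sum_telescope)
    also have "v div 2 ^ Suc r = 0"
      using v by (intro div_less) (auto intro: le_less_trans)
    then have "F (Suc r) = 0" by (auto simp: F_def)
    finally show ?thesis by (simp add: F_def)
  qed
  ultimately show ?thesis by blast
qed

text \<open>An interval is the difference of two prefixes; the coefficients may be negative, and the
  bound on their absolute sum doubles.\<close>

lemma dyadic_interval_decomposition:
  assumes "0 \<le> u" "u \<le> v" "v \<le> 2 ^ r"
  shows "\<exists>\<sigma>. (\<Sum>q\<in>dyad r. \<bar>\<sigma> q\<bar>) \<le> 2 * (real r + 1) \<and>
    (\<forall>t. of_bool (u \<le> t \<and> t < v) = (\<Sum>q\<in>dyad r. \<sigma> q * of_bool (t \<in> dyadic_interval q) :: real))"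
proof -
  have "nat v \<le> 2 ^ r" "nat u \<le> 2 ^ r" using assms by (auto simp: nat_le_iff)
  then obtain \<sigma> \<tau> where
    \<sigma>: "(\<Sum>q\<in>dyad r. \<bar>\<sigma> q\<bar>) \<le> real r + 1"
      "\<And>t. of_bool (0 \<le> t \<and> t < int (nat v)) = (\<Sum>q\<in>dyad r. \<sigma> q * of_bool (t \<in> dyadic_interval q) :: real)" and
    \<tau>: "(\<Sum>q\<in>dyad r. \<bar>\<tau> q\<bar>) \<le> real r + 1"
      "\<And>t. of_bool (0 \<le> t \<and> t < int (nat u)) = (\<Sum>q\<in>dyad r. \<tau> q * of_bool (t \<in> dyadic_interval q) :: real)"
    using dyadic_prefix by meson
  have "(\<Sum>q\<in>dyad r. \<bar>\<sigma> q - \<tau> q\<bar>) \<le> (\<Sum>q\<in>dyad r. \<bar>\<sigma> q\<bar> + \<bar>\<tau> q\<bar>)"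
    by (intro sum_mono abs_triangle_ineq4)
  then have "(\<Sum>q\<in>dyad r. \<bar>\<sigma> q - \<tau> q\<bar>) \<le> 2 * (real r + 1)"
    using \<sigma>(1) \<tau>(1) by (simp add: sum.distrib)
  moreover have "of_bool (u \<le> t \<and> t < v) = (\<Sum>q\<in>dyad r. (\<sigma> q - \<tau> q) * of_bool (t \<in> dyadic_interval q) :: real)" for t
  proof -
    have "(\<Sum>q\<in>dyad r. (\<sigma> q - \<tau> q) * of_bool (t \<in> dyadic_interval q) :: real)
      = of_bool (0 \<le> t \<and> t < int (nat v)) - of_bool (0 \<le> t \<and> t < int (nat u))"
      unfolding \<sigma>(2) \<tau>(2) by (simp add: left_diff_distrib sum_subtractf)
    also have "\<dots> = of_bool (u \<le> t \<and> t < v)" using assms by (auto simp: of_bool_def)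
    finally show ?thesis by simp
  qed
  ultimately show ?thesis by (intro exI[of _ "\<lambda>q. \<sigma> q - \<tau> q"]) auto
qed

lemma card_vec_box:
  fixes A :: "'d::finite \<Rightarrow> int set"
  assumes "\<And>l. finite (A l)"
  shows "finite {i :: int^'d. \<forall>l. i $ l \<in> A l}" "card {i :: int^'d. \<forall>l. i $ l \<in> A l} = (\<Prod>l\<in>UNIV. card (A l))"
proof -
  have bij: "bij_betw (\<lambda>f. \<chi> l. f l) (PiE UNIV A) {i :: int^'d. \<forall>l. i $ l \<in> A l}"
    by (rule bij_betw_byWitness[where f' = "\<lambda>i. vec_nth i"]) (auto simp: PiE_def)
  show "finite {i :: int^'d. \<forall>l. i $ l \<in> A l}"
    using bij_betw_finite[OF bij] assms finite_PiE[of UNIV A] by simp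
  show "card {i :: int^'d. \<forall>l. i $ l \<in> A l} = (\<Prod>l\<in>UNIV. card (A l))"
    using bij_betw_same_card[OF bij] by (simp add: card_PiE)
qed

text \<open>The offset s anchors the dyadic system at a chosen corner, so that its depth is governed
  by the side of the region of interest and not by its position in the lattice.\<close>

definition dyadic_box :: "int^'d \<Rightarrow> ('d \<Rightarrow> nat \<times> nat) \<Rightarrow> (int^'d) set" where
  "dyadic_box s Q = {i. \<forall>l. i $ l - s $ l \<in> dyadic_interval (Q l)}"

lemma dyadic_box_card:
  fixes Q :: "'d::finite \<Rightarrow> nat \<times> nat"
  shows "finite (dyadic_box s Q)" "card (dyadic_box s Q) = (\<Prod>l\<in>UNIV. 2 ^ fst (Q l))"
proof -
  define A where "A l = (\<lambda>t. s $ l + t) ` dyadic_interval (Q l)" for l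
  have eq: "dyadic_box s Q = {i. \<forall>l. i $ l \<in> A l}"
    unfolding dyadic_box_def A_def by (auto simp: image_iff) (metis add_diff_cancel_left' diff_add_cancel add.commute)+
  have fin: "finite (A l)" for l by (simp add: A_def dyadic_interval_def)
  have "card (A l) = 2 ^ fst (Q l)" for l
    unfolding A_def by (subst card_image) (auto simp: dyadic_interval_def algebra_simps nat_power_eq)
  then show "finite (dyadic_box s Q)" "card (dyadic_box s Q) = (\<Prod>l\<in>UNIV. 2 ^ fst (Q l))"
    unfolding eq using card_vec_box[OF fin] by auto
qed

definition dyadic_boxes :: "nat \<Rightarrow> ('d::finite \<Rightarrow> nat \<times> nat) set" where
  "dyadic_boxes r = PiE UNIV (\<lambda>_. dyad r)"

lemma finite_dyadic_boxes [simp]: "finite (dyadic_boxes r)"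
  unfolding dyadic_boxes_def by (rule finite_PiE) auto

text \<open>The indicator of a box is a product of one-dimensional indicators. Multiplying out their
  dyadic expansions gives a combination of dyadic boxes whose absolute coefficients sum to the
  product of the one-dimensional sums.\<close>

lemma sum_box_le_dyadic:
  fixes f :: "int^'d::finite \<Rightarrow> real" and u v :: "'d \<Rightarrow> int"
  assumes fin: "finite \<Lambda>" and uv: "\<And>l. 0 \<le> u l" "\<And>l. u l \<le> v l" "\<And>l. v l \<le> 2 ^ r"
    and Y: "\<And>Q. Q \<in> dyadic_boxes r \<Longrightarrow> \<bar>\<Sum>i\<in>\<Lambda> \<inter> dyadic_box s Q. f i\<bar> \<le> Y"
  shows "\<bar>\<Sum>i\<in>\<Lambda> \<inter> {i. \<forall>l. u l \<le> i $ l - s $ l \<and> i $ l - s $ l < v l}. f i\<bar> \<le> (2 * (real r + 1)) ^ CARD('d) * Y"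
proof -
  define B where "B = {i. \<forall>l. u l \<le> i $ l - s $ l \<and> i $ l - s $ l < v l}"
  have "\<exists>\<sigma>. \<forall>l. (\<Sum>q\<in>dyad r. \<bar>\<sigma> l q\<bar>) \<le> 2 * (real r + 1) \<and>
    (\<forall>t. of_bool (u l \<le> t \<and> t < v l) = (\<Sum>q\<in>dyad r. \<sigma> l q * of_bool (t \<in> dyadic_interval q) :: real))"
    using dyadic_interval_decomposition[OF uv] by (intro choice) auto
  then obtain \<sigma> where \<sigma>: "\<And>l. (\<Sum>q\<in>dyad r. \<bar>\<sigma> l q\<bar>) \<le> 2 * (real r + 1)"
    "\<And>l t. of_bool (u l \<le> t \<and> t < v l) = (\<Sum>q\<in>dyad r. \<sigma> l q * of_bool (t \<in> dyadic_interval q) :: real)"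
    by metis
  have bool_prod: "of_bool (\<forall>l. P l) = (\<Prod>l\<in>UNIV. of_bool (P l) :: real)" for P :: "'d \<Rightarrow> bool"
    by (cases "\<forall>l. P l") (auto simp: prod_zero_iff)
  have ind: "of_bool (i \<in> B) = (\<Sum>Q\<in>dyadic_boxes r. (\<Prod>l\<in>UNIV. \<sigma> l (Q l)) * of_bool (i \<in> dyadic_box s Q))" for i
  proof -
    have "of_bool (i \<in> B) = (\<Prod>l\<in>UNIV. of_bool (u l \<le> i $ l - s $ l \<and> i $ l - s $ l < v l) :: real)"
      unfolding B_def mem_Collect_eq by (rule bool_prod)
    also have "\<dots> = (\<Prod>l\<in>UNIV. \<Sum>q\<in>dyad r. \<sigma> l q * of_bool (i $ l - s $ l \<in> dyadic_interval q))"
      unfolding \<sigma>(2) ..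
    also have "\<dots> = (\<Sum>Q\<in>dyadic_boxes r. \<Prod>l\<in>UNIV. \<sigma> l (Q l) * of_bool (i $ l - s $ l \<in> dyadic_interval (Q l)))"
      unfolding dyadic_boxes_def by (rule prod_sum_PiE) auto
    also have "\<dots> = (\<Sum>Q\<in>dyadic_boxes r. (\<Prod>l\<in>UNIV. \<sigma> l (Q l)) * of_bool (i \<in> dyadic_box s Q))"
      unfolding dyadic_box_def mem_Collect_eq bool_prod by (simp add: prod.distrib)
    finally show ?thesis .
  qed
  have restrict: "(\<Sum>i\<in>\<Lambda> \<inter> A. f i) = (\<Sum>i\<in>\<Lambda>. of_bool (i \<in> A) * f i)" for A
    using fin by (simp add: sum.inter_restrict of_bool_def if_distrib[of "\<lambda>x. x * _"] cong: if_cong)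
  have "(\<Sum>i\<in>\<Lambda> \<inter> B. f i) = (\<Sum>i\<in>\<Lambda>. \<Sum>Q\<in>dyadic_boxes r. (\<Prod>l\<in>UNIV. \<sigma> l (Q l)) * (of_bool (i \<in> dyadic_box s Q) * f i))"
    unfolding restrict ind by (simp only: sum_distrib_right mult.assoc)
  also have "\<dots> = (\<Sum>Q\<in>dyadic_boxes r. (\<Prod>l\<in>UNIV. \<sigma> l (Q l)) * (\<Sum>i\<in>\<Lambda> \<inter> dyadic_box s Q. f i))"
    unfolding restrict by (subst sum.swap) (simp only: sum_distrib_left)
  also have "\<bar>\<dots>\<bar> \<le> (\<Sum>Q\<in>dyadic_boxes r. \<bar>\<Prod>l\<in>UNIV. \<sigma> l (Q l)\<bar> * \<bar>\<Sum>i\<in>\<Lambda> \<inter> dyadic_box s Q. f i\<bar>)"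
    by (rule order.trans[OF sum_abs]) (simp add: abs_mult)
  also have "\<dots> \<le> (\<Sum>Q\<in>dyadic_boxes r. \<bar>\<Prod>l\<in>UNIV. \<sigma> l (Q l)\<bar> * Y)"
    by (intro sum_mono mult_left_mono Y) auto
  also have "\<dots> = (\<Prod>l\<in>UNIV. \<Sum>q\<in>dyad r. \<bar>\<sigma> l q\<bar>) * Y"
    unfolding dyadic_boxes_def by (subst prod_sum_PiE) (auto simp: sum_distrib_right abs_prod)
  also have "\<dots> \<le> (\<Prod>l\<in>(UNIV :: 'd set). 2 * (real r + 1)) * Y"
  proof (intro mult_right_mono prod_mono conjI \<sigma> sum_nonneg)
    \<comment> \<open>One admissible index is enough to force Y to be nonnegative.\<close>
    have "(\<lambda>_. (0, 0)) \<in> (dyadic_boxes r :: ('d \<Rightarrow> _) set)" by (auto simp: dyadic_boxes_def dyad_def)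
    then show "0 \<le> Y" using Y order.trans[OF abs_ge_zero] by blast
  qed auto
  finally show ?thesis by (simp add: B_def)
qed

text \<open>The sum factorises over the coordinates. In one dimension scale j has 2^(r - j)
  intervals of length 2^j, and since p/2 >= 1 they contribute no more than the single interval of
  scale r.\<close>

lemma sum_dyadic_card_powr:
  fixes p :: real
  assumes "p \<ge> 2"
  shows "(\<Sum>Q\<in>(dyadic_boxes r :: ('d::finite \<Rightarrow> _) set). (\<Prod>l\<in>UNIV. 2 ^ fst (Q l)) powr (p / 2))
    \<le> ((real r + 1) * 2 powr (r * (p / 2))) ^ CARD('d)"
proof -
  have "(\<Sum>Q\<in>(dyadic_boxes r :: ('d \<Rightarrow> _) set). (\<Prod>l\<in>UNIV. 2 ^ fst (Q l)) powr (p / 2))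
      = (\<Sum>Q\<in>(dyadic_boxes r :: ('d \<Rightarrow> _) set). \<Prod>l\<in>UNIV. (2 ^ fst (Q l)) powr (p / 2))"
    by (simp add: prod_powr_distrib)
  also have "\<dots> = (\<Prod>l\<in>(UNIV :: 'd set). \<Sum>q\<in>dyad r. (2 ^ fst q) powr (p / 2))"
    unfolding dyadic_boxes_def by (subst prod_sum_PiE) auto
  also have "\<dots> = (\<Sum>q\<in>dyad r. (2 ^ fst q) powr (p / 2)) ^ CARD('d)" by simp
  finally have eq: "(\<Sum>Q\<in>(dyadic_boxes r :: ('d \<Rightarrow> _) set). (\<Prod>l\<in>UNIV. 2 ^ fst (Q l)) powr (p / 2))
      = (\<Sum>q\<in>dyad r. (2 ^ fst q) powr (p / 2)) ^ CARD('d)" .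
  have "(\<Sum>q\<in>dyad r. (2 ^ fst q) powr (p / 2)) = (\<Sum>j\<le>r. \<Sum>m<(2::nat) ^ (r - j). (2 ^ j :: real) powr (p / 2))"
    unfolding dyad_def by (subst sum.Sigma) (auto simp: case_prod_beta)
  also have "\<dots> \<le> (\<Sum>j\<le>r. 2 powr (r * (p / 2)))"
  proof (rule sum_mono)
    fix j assume "j \<in> {..r}"
    then have "(2::real) ^ (r - j) * (2 ^ j) powr (p / 2) = 2 powr (real r - real j + real j * (p / 2))"
      by (simp add: powr_add powr_powr powr_realpow of_nat_diff flip: powr_realpow)
    also have "\<dots> \<le> 2 powr (r * (p / 2))"
    proof (rule powr_mono)
      have "(real r - real j) * 1 \<le> (real r - real j) * (p / 2)"
        using \<open>j \<in> {..r}\<close> assms by (intro mult_left_mono) auto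
      then show "real r - real j + real j * (p / 2) \<le> real r * (p / 2)" by (simp add: algebra_simps)
    qed auto
    finally show "(\<Sum>m<(2::nat) ^ (r - j). (2 ^ j :: real) powr (p / 2)) \<le> 2 powr (r * (p / 2))" by simp
  qed
  also have "\<dots> = (real r + 1) * 2 powr (r * (p / 2))" by simp
  finally show ?thesis unfolding eq by (intro power_mono sum_nonneg) auto
qed

section \<open>Moments of the supremum over boxes\<close>

context C3_field
begin

text \<open>A sum of p-th powers in place of a maximum: it dominates the p-th power of each dyadic
  box sum, and its expectation is available term by term.\<close>

definition dyadic_moment_sum :: "((int, 'd) vec \<Rightarrow> real) \<Rightarrow> (int, 'd) vec set \<Rightarrow> (int, 'd) vec \<Rightarrow> nat \<Rightarrow> 'a \<Rightarrow> real" where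
  "dyadic_moment_sum w \<Lambda> s r \<omega> = (\<Sum>Q\<in>dyadic_boxes r. \<bar>psum w (\<Lambda> \<inter> dyadic_box s Q) \<omega>\<bar> powr p)"

lemma dyadic_moment_sum_measurable [measurable]: "dyadic_moment_sum w \<Lambda> s r \<in> borel_measurable M"
  unfolding dyadic_moment_sum_def by measurable

lemma dyadic_moment_sum_nonneg: "dyadic_moment_sum w \<Lambda> s r \<omega> \<ge> 0"
  unfolding dyadic_moment_sum_def by (intro sum_nonneg) auto

text \<open>The bound is pathwise and its right side does not involve u and v, so it covers all
  boxes inside the dyadic cube at once.\<close>

lemma psum_box_le:
  fixes u v :: "'d \<Rightarrow> int"
  assumes fin: "finite \<Lambda>" and uv: "\<And>l. 0 \<le> u l" "\<And>l. u l \<le> v l" "\<And>l. v l \<le> 2 ^ r"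
  shows "\<bar>psum w (\<Lambda> \<inter> {i. \<forall>l. u l \<le> i $ l - s $ l \<and> i $ l - s $ l < v l}) \<omega>\<bar>
    \<le> (2 * (real r + 1)) ^ CARD('d) * dyadic_moment_sum w \<Lambda> s r \<omega> powr (1 / p)"
  unfolding psum_def
proof (rule sum_box_le_dyadic[OF fin uv])
  fix Q :: "'d \<Rightarrow> nat \<times> nat" assume Q: "Q \<in> dyadic_boxes r"
  have "\<bar>psum w (\<Lambda> \<inter> dyadic_box s Q) \<omega>\<bar> powr p \<le> dyadic_moment_sum w \<Lambda> s r \<omega>"
    unfolding dyadic_moment_sum_def using Q by (intro member_le_sum) auto
  then have "(\<bar>psum w (\<Lambda> \<inter> dyadic_box s Q) \<omega>\<bar> powr p) powr (1 / p) \<le> dyadic_moment_sum w \<Lambda> s r \<omega> powr (1 / p)"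
    using p_gt by (intro powr_mono2) auto
  then show "\<bar>\<Sum>i\<in>\<Lambda> \<inter> dyadic_box s Q. w i * eps i \<omega>\<bar> \<le> dyadic_moment_sum w \<Lambda> s r \<omega> powr (1 / p)"
    using p_gt by (simp add: powr_powr psum_def)
qed

lemma dyadic_moment_sum_integral:
  assumes fin: "finite \<Lambda>" and W: "\<And>i. \<bar>w i\<bar> \<le> W"
  shows "integrable M (dyadic_moment_sum w \<Lambda> s r)"
    and "(\<integral>\<omega>. dyadic_moment_sum w \<Lambda> s r \<omega> \<partial>M)
      \<le> (2 * p * (p - 1) * W\<^sup>2 * dep_total) powr (p / 2) * ((real r + 1) * 2 powr (r * (p / 2))) ^ CARD('d)"
proof -
  have int: "integrable M (\<lambda>\<omega>. \<bar>psum w (\<Lambda> \<inter> dyadic_box s Q) \<omega>\<bar> powr p)" for Q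
    using fin by (intro psum_Lp) auto
  then show "integrable M (dyadic_moment_sum w \<Lambda> s r)"
    unfolding dyadic_moment_sum_def[abs_def] by (intro Bochner_Integration.integrable_sum)
  define c where "c = 2 * p * (p - 1) * W\<^sup>2 * dep_total"
  have c: "c \<ge> 0" using p_gt dep_total_nonneg by (simp add: c_def)
  have "(\<integral>\<omega>. dyadic_moment_sum w \<Lambda> s r \<omega> \<partial>M) = (\<Sum>Q\<in>dyadic_boxes r. mom w (\<Lambda> \<inter> dyadic_box s Q))"
    unfolding dyadic_moment_sum_def mom_def using int by (intro Bochner_Integration.integral_sum)
  also have "\<dots> \<le> (\<Sum>Q\<in>(dyadic_boxes r :: ('d \<Rightarrow> _) set). c powr (p / 2) * (\<Prod>l\<in>UNIV. 2 ^ fst (Q l)) powr (p / 2))"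
  proof (rule sum_mono)
    fix Q :: "'d \<Rightarrow> nat \<times> nat"
    have "mom w (\<Lambda> \<inter> dyadic_box s Q) \<le> (c * card (\<Lambda> \<inter> dyadic_box s Q)) powr (p / 2)"
      unfolding c_def using fin W by (intro moment_inequality) auto
    also have "\<dots> \<le> (c * card (dyadic_box s Q)) powr (p / 2)"
      using c p_gt dyadic_box_card(1)[of s Q] by (intro powr_mono2 mult_left_mono) (auto intro: card_mono)
    also have "\<dots> = c powr (p / 2) * (\<Prod>l\<in>UNIV. 2 ^ fst (Q l)) powr (p / 2)"
      using c by (simp add: dyadic_box_card powr_mult prod_nonneg)
    finally show "mom w (\<Lambda> \<inter> dyadic_box s Q) \<le> c powr (p / 2) * (\<Prod>l\<in>UNIV. 2 ^ fst (Q l)) powr (p / 2)" .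
  qed
  also have "\<dots> = c powr (p / 2) * (\<Sum>Q\<in>(dyadic_boxes r :: ('d \<Rightarrow> _) set). (\<Prod>l\<in>UNIV. 2 ^ fst (Q l)) powr (p / 2))"
    by (simp add: sum_distrib_left)
  also have "\<dots> \<le> c powr (p / 2) * ((real r + 1) * 2 powr (r * (p / 2))) ^ CARD('d)"
    using p_gt by (intro mult_left_mono sum_dyadic_card_powr) auto
  finally show "(\<integral>\<omega>. dyadic_moment_sum w \<Lambda> s r \<omega> \<partial>M)
      \<le> (2 * p * (p - 1) * W\<^sup>2 * dep_total) powr (p / 2) * ((real r + 1) * 2 powr (r * (p / 2))) ^ CARD('d)"
    unfolding c_def .
qed

end

text \<open>Markov's inequality at level 1, then Borel-Cantelli; the desired rate is put into the
  normalisation of Z.\<close>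

lemma (in prob_space) AE_eventually_le_one_of_summable:
  assumes int: "\<And>n. integrable M (Z n)" and nn: "\<And>n \<omega>. Z n \<omega> \<ge> (0::real)"
    and le: "eventually (\<lambda>n. (\<integral>\<omega>. Z n \<omega> \<partial>M) \<le> b n) sequentially" and "summable b"
  shows "AE \<omega> in M. eventually (\<lambda>n. Z n \<omega> \<le> 1) sequentially"
proof -
  have [measurable]: "Z n \<in> borel_measurable M" for n using int by auto
  define A where "A n = {\<omega> \<in> space M. Z n \<omega> \<ge> 1}" for n
  have [measurable]: "A n \<in> sets M" for n unfolding A_def by measurable
  have "prob (A n) \<le> (\<integral>\<omega>. Z n \<omega> \<partial>M)" for n
    using integral_Markov_inequality_measure[OF int[of n], of "{}" 1] nn by (simp add: A_def)
  with le have "eventually (\<lambda>n. norm (prob (A n)) \<le> b n) sequentially"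
    by (auto elim!: eventually_mono intro: order.trans)
  then have "summable (\<lambda>n. prob (A n))" using \<open>summable b\<close> by (rule summable_comparison_test_ev)
  then have "AE \<omega> in M. eventually (\<lambda>n. \<omega> \<in> space M - A n) sequentially"
    by (intro borel_cantelli_AE1) (auto simp: less_top[symmetric])
  then show ?thesis
    by eventually_elim (auto simp: A_def elim!: eventually_mono)
qed

subsection \<open>The kernel estimator\<close>

lemma supnormR_le_iff: "supnormR x \<le> t \<longleftrightarrow> (\<forall>l. \<bar>x $ l\<bar> \<le> t)"
  unfolding supnormR_def by (subst Max_le_iff) auto

lemma abs_component_le_supnormR: "\<bar>x $ l\<bar> \<le> supnormR x"
  using supnormR_le_iff[of x "supnormR x"] by simp

lemma Lambda_n_eq: "(Lambda_n n :: (int^'d) set) = {i. \<forall>l. i $ l \<in> {1..int n}}"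
  unfolding Lambda_n_def by auto

lemma Lambda_n_card: "finite (Lambda_n n :: (int^'d) set)" "card (Lambda_n n :: (int^'d) set) = n ^ CARD('d)"
  unfolding Lambda_n_eq using card_vec_box[of "\<lambda>_. {1..int n}"] by auto

lemma Lambda_n_mono: "m \<le> n \<Longrightarrow> Lambda_n m \<subseteq> Lambda_n n"
  unfolding Lambda_n_def by (auto intro: order.trans)

text \<open>Near the ends of 1..n part of the window is lost. Depending on the side of n/2 on which
  y lies, its left or its right half stays inside because H <= n/2. That half contains at least H -
  1 integers, and H >= 2 turns this into H/2.\<close>

lemma card_lattice_window_ge:
  fixes y H :: real and n :: nat
  assumes y: "0 \<le> y" "y \<le> n" and H: "2 \<le> H" "H \<le> n / 2"
  shows "finite {i::int. 1 \<le> i \<and> i \<le> n \<and> \<bar>y - i\<bar> \<le> H}"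
    and "H / 2 \<le> card {i::int. 1 \<le> i \<and> i \<le> n \<and> \<bar>y - i\<bar> \<le> H}"
proof -
  define A where "A = {i::int. 1 \<le> i \<and> i \<le> n \<and> \<bar>y - i\<bar> \<le> H}"
  have "A \<subseteq> {1..int n}" by (auto simp: A_def)
  then have fin: "finite A" by (rule finite_subset) simp
  then show "finite {i::int. 1 \<le> i \<and> i \<le> n \<and> \<bar>y - i\<bar> \<le> H}" by (simp add: A_def)
  have "\<exists>a b. {a + 1..b} \<subseteq> A \<and> H - 1 \<le> of_int (b - a)"
  proof (cases "y \<ge> n / 2")
    case True
    have "i \<in> A" if "i \<in> {\<lfloor>y - H\<rfloor> + 1..\<lfloor>y\<rfloor>}" for i
    proof -
      have i: "of_int i > y - H" "of_int i \<le> y" using that by (auto simp: le_floor_iff) linarith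
      then have "real_of_int i > 0" "real_of_int i \<le> real n" using True H y by linarith+
      then show ?thesis using i by (simp add: A_def)
    qed
    moreover have "H - 1 \<le> of_int (\<lfloor>y\<rfloor> - \<lfloor>y - H\<rfloor>)" by linarith
    ultimately show ?thesis by blast
  next
    case False
    have "i \<in> A" if "i \<in> {\<lfloor>y\<rfloor> + 1..\<lfloor>y + H\<rfloor>}" for i
    proof -
      have i: "of_int i > y" "of_int i \<le> y + H" using that by (auto simp: le_floor_iff) linarith
      then have "real_of_int i > 0" "real_of_int i \<le> real n" using False H y by linarith+
      then show ?thesis using i by (simp add: A_def)
    qed
    moreover have "H - 1 \<le> of_int (\<lfloor>y + H\<rfloor> - \<lfloor>y\<rfloor>)" by linarith
    ultimately show ?thesis by blast
  qed
  then obtain a b where ab: "{a + 1..b} \<subseteq> A" "H - 1 \<le> of_int (b - a)" by blast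
  have "H / 2 \<le> of_int (b - a)" using ab(2) H by linarith
  also have "\<dots> \<le> real (card {a + 1..b})" by (simp add: nat_diff_distrib')
  also have "\<dots> \<le> card A" using card_mono[OF fin ab(1)] by simp
  finally show "H / 2 \<le> card {i::int. 1 \<le> i \<and> i \<le> n \<and> \<bar>y - i\<bar> \<le> H}" by (simp add: A_def)
qed

locale kernel_field = C3_field M eps p
  for M :: "'a measure" and eps :: "(int, 'd::{finite,linorder}) vec \<Rightarrow> 'a \<Rightarrow> real" and p :: real +
  fixes K :: "(real, 'd) vec \<Rightarrow> real" and \<eta> c C :: real
  assumes K_nonneg: "\<And>x. K x \<ge> 0"
    and K_supp: "\<And>x. supnormR x > 1 \<Longrightarrow> K x = 0"
    and \<eta>_pos: "\<eta> > 0"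
    and K_lip: "\<And>x y. supnormR x \<le> 1 \<Longrightarrow> supnormR y \<le> 1 \<Longrightarrow> \<bar>K x - K y\<bar> \<le> \<eta> * supnormR (x - y)"
    and cC: "c > 0" "C > 0"
    and K_bounds: "\<And>x. supnormR x \<le> 1 \<Longrightarrow> c \<le> K x \<and> K x \<le> C"
begin

text \<open>K composed with the coordinatewise projection onto the cube. Unlike K it is Lipschitz on
  the whole space; the jump of K is left to the indicator of the window.\<close>

definition K_ext :: "(real, 'd) vec \<Rightarrow> real" where
  "K_ext x = K (\<chi> l. max (- 1) (min 1 (x $ l)))"

lemma K_ext_bound: "\<bar>K_ext x\<bar> \<le> C"
proof -
  have "supnormR (\<chi> l. max (- 1) (min 1 (x $ l))) \<le> 1" by (auto simp: supnormR_le_iff)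
  then show ?thesis using K_bounds K_nonneg by (auto simp: K_ext_def)
qed

lemma K_ext_lipschitz: "\<bar>K_ext x - K_ext y\<bar> \<le> \<eta> * supnormR (x - y)"
proof -
  define cl where "cl x = (\<chi> l. max (- 1) (min 1 (x $ l)))" for x :: "(real, 'd) vec"
  have "supnormR (cl x) \<le> 1" for x by (auto simp: supnormR_le_iff cl_def)
  then have "\<bar>K_ext x - K_ext y\<bar> \<le> \<eta> * supnormR (cl x - cl y)"
    unfolding K_ext_def cl_def[symmetric] by (intro K_lip)
  also have "supnormR (cl x - cl y) \<le> supnormR (x - y)"
  proof (unfold supnormR_le_iff, rule allI)
    fix l
    have "\<bar>(cl x - cl y) $ l\<bar> \<le> \<bar>(x - y) $ l\<bar>" unfolding cl_def by (simp add: max_def min_def)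
    then show "\<bar>(cl x - cl y) $ l\<bar> \<le> supnormR (x - y)" using abs_component_le_supnormR order.trans by blast
  qed
  finally show ?thesis using \<eta>_pos by simp
qed

lemma K_ext_eq:
  assumes "supnormR x \<le> 1"
  shows "K_ext x = K x"
proof -
  have "max (- 1) (min 1 (x $ l)) = x $ l" for l
    using assms[unfolded supnormR_le_iff, rule_format, of l] by linarith
  then show ?thesis by (simp add: K_ext_def)
qed

definition window :: "nat \<Rightarrow> real \<Rightarrow> (real, 'd) vec \<Rightarrow> (int, 'd) vec set" where
  "window n hh x = {i. \<forall>l. \<bar>n * x $ l - i $ l\<bar> \<le> n * hh}"

lemma supnormR_scaled_iff:
  assumes "n > 0" "hh > 0"
  shows "supnormR ((1 / hh) *\<^sub>R (x - scaled_index n i)) \<le> 1 \<longleftrightarrow> i \<in> window n hh x"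
proof -
  have "\<bar>((1 / hh) *\<^sub>R (x - scaled_index n i)) $ l\<bar> \<le> 1 \<longleftrightarrow> \<bar>n * x $ l - i $ l\<bar> \<le> n * hh" for l
  proof -
    have "((1 / hh) *\<^sub>R (x - scaled_index n i)) $ l = (n * x $ l - i $ l) / (n * hh)"
      using assms by (simp add: scaled_index_def field_simps)
    then show ?thesis using assms by (simp add: abs_mult)
  qed
  then show ?thesis by (simp add: supnormR_le_iff window_def)
qed

lemma K_scaled_eq:
  assumes "n > 0" "hh > 0"
  shows "K ((1 / hh) *\<^sub>R (x - scaled_index n i))
    = (if i \<in> window n hh x then K_ext ((1 / hh) *\<^sub>R (x - scaled_index n i)) else 0)"
  using supnormR_scaled_iff[OF assms, of x i] K_ext_eq K_supp by (auto simp: not_le)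

text \<open>Even at the boundary of the cube the window holds at least (n hh / 2)^d design points,
  and K is at least c on each of them.\<close>

lemma kernel_sum_ge:
  assumes x: "x \<in> unit_cube" and n: "n > 0" and hh: "hh \<le> 1 / 2" "n * hh \<ge> 2"
  shows "c * (n * hh / 2) ^ CARD('d) \<le> (\<Sum>i\<in>Lambda_n n. K ((1 / hh) *\<^sub>R (x - scaled_index n i)))"
proof -
  have hh0: "hh > 0" using hh n by (metis less_le_not_le linorder_not_le mult_nonneg_nonpos of_nat_0_le_iff order.trans zero_less_numeral)
  define A where "A l = {i::int. 1 \<le> i \<and> i \<le> n \<and> \<bar>n * x $ l - i\<bar> \<le> n * hh}" for l
  have A: "finite (A l)" "n * hh / 2 \<le> card (A l)" for l
    unfolding A_def using x hh n by (intro card_lattice_window_ge; auto simp: unit_cube_def mult_left_le)+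
  have eq: "Lambda_n n \<inter> window n hh x = {i. \<forall>l. i $ l \<in> A l}"
    unfolding Lambda_n_def window_def A_def by auto
  have "(n * hh / 2) ^ CARD('d) = (\<Prod>l\<in>(UNIV::'d set). n * hh / 2)" by simp
  also have "\<dots> \<le> (\<Prod>l\<in>UNIV. real (card (A l)))" using A(2) hh0 by (intro prod_mono) auto
  also have "\<dots> = card (Lambda_n n \<inter> window n hh x)"
    unfolding eq using card_vec_box(2)[of A, OF A(1)] by simp
  finally have "c * (n * hh / 2) ^ CARD('d) \<le> c * card (Lambda_n n \<inter> window n hh x)"
    using cC by simp
  also have "\<dots> = (\<Sum>i\<in>Lambda_n n \<inter> window n hh x. c)" by simp
  also have "\<dots> \<le> (\<Sum>i\<in>Lambda_n n \<inter> window n hh x. K ((1 / hh) *\<^sub>R (x - scaled_index n i)))"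
    using supnormR_scaled_iff[OF n hh0] K_bounds by (intro sum_mono) auto
  also have "\<dots> \<le> (\<Sum>i\<in>Lambda_n n. K ((1 / hh) *\<^sub>R (x - scaled_index n i)))"
    using Lambda_n_card K_nonneg by (intro sum_mono2) auto
  finally show ?thesis .
qed

section \<open>Reduction to a grid and to dyadic boxes\<close>

definition grid_point :: "nat \<Rightarrow> ('d \<Rightarrow> nat) \<Rightarrow> (real, 'd) vec" where
  "grid_point R k = (\<chi> l. real (k l) / real R)"

definition grid :: "nat \<Rightarrow> ('d \<Rightarrow> nat) set" where
  "grid R = PiE UNIV (\<lambda>_. {..R})"

lemma grid_card: "finite (grid R)" "card (grid R) = (R + 1) ^ CARD('d)"
  unfolding grid_def by (auto intro!: finite_PiE simp: card_PiE)

lemma grid_approximation: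
  assumes x: "x \<in> unit_cube" and R: "R > 0"
  obtains k where "k \<in> grid R" "supnormR (x - grid_point R k) \<le> 1 / R"
proof
  define k where "k l = nat \<lfloor>R * x $ l\<rfloor>" for l
  have x': "0 \<le> x $ l" "x $ l \<le> 1" for l using x by (auto simp: unit_cube_def)
  have "k l \<le> R" for l
  proof -
    have "R * x $ l \<le> R" using x' R by simp
    then show ?thesis unfolding k_def by linarith
  qed
  then show "k \<in> grid R" by (auto simp: grid_def)
  have "\<bar>(x - grid_point R k) $ l\<bar> \<le> 1 / R" for l
  proof -
    have "real (k l) = of_int \<lfloor>R * x $ l\<rfloor>" using x'[of l] by (simp add: k_def)
    then have "\<bar>R * x $ l - k l\<bar> \<le> 1" by linarith
    moreover have "(x - grid_point R k) $ l = (R * x $ l - k l) / R" using R by (simp add: grid_point_def field_simps)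
    ultimately show ?thesis using R by (simp add: divide_right_mono)
  qed
  then show "supnormR (x - grid_point R k) \<le> 1 / R" by (simp add: supnormR_le_iff)
qed

text \<open>Defined for every lattice point and not only inside the window of x: the weights of a
  frozen x remain usable on windows centred elsewhere.\<close>

definition weight :: "nat \<Rightarrow> real \<Rightarrow> (real, 'd) vec \<Rightarrow> (int, 'd) vec \<Rightarrow> real" where
  "weight n hh x i = K_ext ((1 / hh) *\<^sub>R (x - scaled_index n i))"

text \<open>Lower corner of the cube of half side 2 n hh about n x, which contains the window of
  every point within distance hh of x.\<close>

definition corner :: "nat \<Rightarrow> real \<Rightarrow> (real, 'd) vec \<Rightarrow> (int, 'd) vec" where
  "corner n hh x = (\<chi> l. \<lceil>n * x $ l - 2 * (n * hh)\<rceil>)"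

text \<open>With H = n hh, the offsets of a nearby window from the corner are at most 4 H + 1, the 1
  coming from the half-open upper end.\<close>

definition depth :: "real \<Rightarrow> nat" where
  "depth H = nat \<lceil>log 2 (4 * H + 1)\<rceil>"

lemma depth_bounds:
  assumes "H \<ge> 1"
  shows "4 * H + 1 \<le> 2 ^ depth H" "(2::real) ^ depth H \<le> 10 * H"
proof -
  have l: "log 2 (4 * H + 1) \<ge> 0" using assms by simp
  have d: "real (depth H) = of_int \<lceil>log 2 (4 * H + 1)\<rceil>" unfolding depth_def using l by simp
  have "4 * H + 1 = 2 powr (log 2 (4 * H + 1))" using assms by simp
  also have "\<dots> \<le> 2 powr (depth H)" unfolding d by (intro powr_mono) auto
  finally show "4 * H + 1 \<le> 2 ^ depth H" by (simp add: powr_realpow)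
  have "2 ^ depth H = 2 powr (depth H)" by (simp add: powr_realpow)
  also have "\<dots> \<le> 2 powr (log 2 (4 * H + 1) + 1)" unfolding d by (intro powr_mono) linarith+
  also have "\<dots> = (4 * H + 1) * 2" using assms by (simp add: powr_add)
  also have "\<dots> \<le> 10 * H" using assms by simp
  finally show "(2::real) ^ depth H \<le> 10 * H" .
qed

text \<open>Once more a sum replaces a maximum, now over grid points; in expectation it acts as a
  union bound.\<close>

definition grid_moment_sum :: "nat \<Rightarrow> real \<Rightarrow> nat \<Rightarrow> 'a \<Rightarrow> real" where
  "grid_moment_sum n hh R \<omega> = (\<Sum>k\<in>grid R. dyadic_moment_sum (weight n hh (grid_point R k)) (Lambda_n n)
     (corner n hh (grid_point R k)) (depth (n * hh)) \<omega>)"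

lemma grid_moment_sum_nonneg: "grid_moment_sum n hh R \<omega> \<ge> 0"
  unfolding grid_moment_sum_def by (intro sum_nonneg dyadic_moment_sum_nonneg)

lemma grid_moment_sum_integral:
  shows "integrable M (grid_moment_sum n hh R)"
    and "(\<integral>\<omega>. grid_moment_sum n hh R \<omega> \<partial>M) \<le> (real R + 1) ^ CARD('d) *
      ((2 * p * (p - 1) * C\<^sup>2 * dep_total) powr (p / 2) * ((real (depth (n * hh)) + 1) * 2 powr (depth (n * hh) * (p / 2))) ^ CARD('d))"
    (is "_ \<le> _ * ?B")
proof -
  note * = dyadic_moment_sum_integral[where w = "weight n hh x" and W = C and \<Lambda> = "Lambda_n n" for x,
      OF Lambda_n_card(1)]
  have w: "\<bar>weight n hh x i\<bar> \<le> C" for x i unfolding weight_def by (rule K_ext_bound)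
  show "integrable M (grid_moment_sum n hh R)"
    unfolding grid_moment_sum_def[abs_def] using w by (intro Bochner_Integration.integrable_sum *(1))
  have "(\<integral>\<omega>. grid_moment_sum n hh R \<omega> \<partial>M) = (\<Sum>k\<in>grid R. (\<integral>\<omega>. dyadic_moment_sum (weight n hh (grid_point R k)) (Lambda_n n)
     (corner n hh (grid_point R k)) (depth (n * hh)) \<omega> \<partial>M))"
    unfolding grid_moment_sum_def using w by (intro Bochner_Integration.integral_sum *(1))
  also have "\<dots> \<le> (\<Sum>k\<in>grid R. ?B)" using w by (intro sum_mono *(2))
  also have "\<dots> = (real R + 1) ^ CARD('d) * ?B" by (simp add: grid_card add.commute)
  finally show "(\<integral>\<omega>. grid_moment_sum n hh R \<omega> \<partial>M) \<le> (real R + 1) ^ CARD('d) * ?B" .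
qed

lemma noise_sum_le:
  assumes x: "x \<in> unit_cube" and n: "n > 0" and R: "R > 0" "1 / R \<le> hh" and H: "n * hh \<ge> 1"
  shows "\<bar>\<Sum>i\<in>Lambda_n n. eps i \<omega> * K ((1 / hh) *\<^sub>R (x - scaled_index n i))\<bar>
    \<le> (2 * (real (depth (n * hh)) + 1)) ^ CARD('d) * grid_moment_sum n hh R \<omega> powr (1 / p)
      + \<eta> / (R * hh) * (\<Sum>i\<in>Lambda_n n. \<bar>eps i \<omega>\<bar>)"
proof -
  have "0 < 1 / real R" using R by simp
  with R have hh0: "hh > 0" by linarith
  obtain k where k: "k \<in> grid R" "supnormR (x - grid_point R k) \<le> 1 / R"
    using grid_approximation[OF x R(1)] .
  define x0 where "x0 = grid_point R k"
  define s where "s = corner n hh x0"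
  \<comment> \<open>Half-open integer bounds of the window of x, measured from the corner that
    belongs to x0.\<close>
  define u v where "u l = \<lceil>n * x $ l - n * hh\<rceil> - s $ l" and "v l = \<lfloor>n * x $ l + n * hh\<rfloor> + 1 - s $ l" for l
  have near: "\<bar>n * x $ l - n * x0 $ l\<bar> \<le> n * hh" for l
  proof -
    have "\<bar>(x - x0) $ l\<bar> \<le> hh" using k(2) R(2) unfolding supnormR_le_iff x0_def by (meson order.trans)
    then have "real n * \<bar>(x - x0) $ l\<bar> \<le> n * hh" by (intro mult_left_mono) auto
    moreover have "n * x $ l - n * x0 $ l = n * (x - x0) $ l" by (simp add: right_diff_distrib)
    ultimately show ?thesis by (simp only: abs_mult abs_of_nat)
  qed
  have s: "s $ l = \<lceil>n * x0 $ l - 2 * (n * hh)\<rceil>" for l by (simp add: s_def corner_def)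
  have "0 \<le> u l" for l
  proof -
    have "n * x0 $ l - 2 * (n * hh) \<le> n * x $ l - n * hh" using near[of l] by linarith
    then show ?thesis unfolding u_def s by (simp add: ceiling_mono)
  qed
  moreover have "u l \<le> v l" for l
  proof -
    have "\<lceil>n * x $ l - n * hh\<rceil> \<le> \<lceil>n * x $ l\<rceil>" "\<lfloor>n * x $ l\<rfloor> \<le> \<lfloor>n * x $ l + n * hh\<rfloor>"
      using H by (auto intro: ceiling_mono floor_mono)
    then show ?thesis unfolding u_def v_def using ceiling_diff_floor_le_1[of "n * x $ l"] by linarith
  qed
  moreover have "v l \<le> 2 ^ depth (n * hh)" for l
  proof -
    have "of_int (v l) \<le> 4 * (n * hh) + 1" unfolding v_def s using near[of l] by linarith
    also have "\<dots> \<le> 2 ^ depth (n * hh)" using depth_bounds(1)[OF H] .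
    finally have "real_of_int (v l) \<le> of_int (2 ^ depth (n * hh))" by simp
    then show ?thesis by (simp only: of_int_le_iff)
  qed
  ultimately have uv: "\<And>l. 0 \<le> u l" "\<And>l. u l \<le> v l" "\<And>l. v l \<le> 2 ^ depth (n * hh)" by auto
  have win: "window n hh x = {i. \<forall>l. u l \<le> i $ l - s $ l \<and> i $ l - s $ l < v l}"
  proof -
    have "\<bar>n * x $ l - i\<bar> \<le> n * hh \<longleftrightarrow> u l \<le> i - s $ l \<and> i - s $ l < v l" for l and i :: int
    proof -
      have "u l \<le> i - s $ l \<longleftrightarrow> n * x $ l - n * hh \<le> i" unfolding u_def by (simp add: ceiling_le_iff)
      moreover have "i - s $ l < v l \<longleftrightarrow> i \<le> n * x $ l + n * hh" unfolding v_def by (simp add: le_floor_iff zle_add1_eq_le)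
      ultimately show ?thesis by (auto simp: abs_le_iff)
    qed
    then show ?thesis unfolding window_def by simp
  qed
  have "\<bar>psum (weight n hh x0) (Lambda_n n \<inter> window n hh x) \<omega>\<bar>
     \<le> (2 * (real (depth (n * hh)) + 1)) ^ CARD('d) * dyadic_moment_sum (weight n hh x0) (Lambda_n n) s (depth (n * hh)) \<omega> powr (1 / p)"
    unfolding win using Lambda_n_card(1) uv by (rule psum_box_le)
  also have "\<dots> \<le> (2 * (real (depth (n * hh)) + 1)) ^ CARD('d) * grid_moment_sum n hh R \<omega> powr (1 / p)"
  proof (intro mult_left_mono powr_mono2)
    show "dyadic_moment_sum (weight n hh x0) (Lambda_n n) s (depth (n * hh)) \<omega> \<le> grid_moment_sum n hh R \<omega>"
      unfolding grid_moment_sum_def x0_def s_def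
      using k(1) grid_card(1) dyadic_moment_sum_nonneg by (intro member_le_sum) auto
  qed (use p_gt dyadic_moment_sum_nonneg in auto)
  finally have box: "\<bar>psum (weight n hh x0) (Lambda_n n \<inter> window n hh x) \<omega>\<bar>
     \<le> (2 * (real (depth (n * hh)) + 1)) ^ CARD('d) * grid_moment_sum n hh R \<omega> powr (1 / p)" .
  have dw: "\<bar>weight n hh x i - weight n hh x0 i\<bar> \<le> \<eta> / (R * hh)" for i
  proof -
    have "\<bar>weight n hh x i - weight n hh x0 i\<bar> \<le> \<eta> * supnormR ((1 / hh) *\<^sub>R (x - scaled_index n i) - (1 / hh) *\<^sub>R (x0 - scaled_index n i))"
      unfolding weight_def by (rule K_ext_lipschitz)
    also have "(1 / hh) *\<^sub>R (x - scaled_index n i) - (1 / hh) *\<^sub>R (x0 - scaled_index n i) = (1 / hh) *\<^sub>R (x - x0)"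
      by (simp add: scaleR_diff_right)
    also have "supnormR ((1 / hh) *\<^sub>R (x - x0)) \<le> 1 / (R * hh)"
      unfolding supnormR_le_iff
    proof
      fix l
      have "\<bar>(x - x0) $ l\<bar> \<le> 1 / R" using k(2) unfolding supnormR_le_iff x0_def by blast
      then show "\<bar>((1 / hh) *\<^sub>R (x - x0)) $ l\<bar> \<le> 1 / (R * hh)"
        using hh0 R by (simp add: abs_mult field_simps)
    qed
    finally show ?thesis using \<eta>_pos by (simp add: mult_left_mono)
  qed
  have fin: "finite (Lambda_n n :: (int, 'd) vec set)" by (rule Lambda_n_card)
  have "(\<Sum>i\<in>Lambda_n n. eps i \<omega> * K ((1 / hh) *\<^sub>R (x - scaled_index n i)))
      = (\<Sum>i\<in>Lambda_n n. if i \<in> window n hh x then eps i \<omega> * weight n hh x i else 0)"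
    unfolding K_scaled_eq[OF n hh0] weight_def by (intro sum.cong) auto
  also have "\<dots> = (\<Sum>i\<in>Lambda_n n \<inter> window n hh x. eps i \<omega> * weight n hh x i)"
    using fin by (simp add: sum.inter_restrict)
  also have "\<dots> = psum (weight n hh x0) (Lambda_n n \<inter> window n hh x) \<omega>
      + (\<Sum>i\<in>Lambda_n n \<inter> window n hh x. (weight n hh x i - weight n hh x0 i) * eps i \<omega>)"
    unfolding psum_def sum.distrib[symmetric] by (intro sum.cong) (auto simp: algebra_simps)
  also have "\<bar>\<dots>\<bar> \<le> (2 * (real (depth (n * hh)) + 1)) ^ CARD('d) * grid_moment_sum n hh R \<omega> powr (1 / p)
      + \<eta> / (R * hh) * (\<Sum>i\<in>Lambda_n n. \<bar>eps i \<omega>\<bar>)"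
  proof (rule order.trans[OF abs_triangle_ineq add_mono[OF box]])
    have "\<bar>\<Sum>i\<in>Lambda_n n \<inter> window n hh x. (weight n hh x i - weight n hh x0 i) * eps i \<omega>\<bar>
      \<le> (\<Sum>i\<in>Lambda_n n \<inter> window n hh x. \<bar>weight n hh x i - weight n hh x0 i\<bar> * \<bar>eps i \<omega>\<bar>)"
      by (rule order.trans[OF sum_abs]) (simp add: abs_mult)
    also have "\<dots> \<le> (\<Sum>i\<in>Lambda_n n \<inter> window n hh x. \<eta> / (R * hh) * \<bar>eps i \<omega>\<bar>)"
      by (intro sum_mono mult_right_mono dw) auto
    \<comment> \<open>Dropping the window leaves a sum of absolute values that is free of x and
      monotone in n.\<close>
    also have "\<dots> \<le> (\<Sum>i\<in>Lambda_n n. \<eta> / (R * hh) * \<bar>eps i \<omega>\<bar>)"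
      using fin \<eta>_pos hh0 by (intro sum_mono2) auto
    finally show "\<bar>\<Sum>i\<in>Lambda_n n \<inter> window n hh x. (weight n hh x i - weight n hh x0 i) * eps i \<omega>\<bar>
      \<le> \<eta> / (R * hh) * (\<Sum>i\<in>Lambda_n n. \<bar>eps i \<omega>\<bar>)" by (simp add: sum_distrib_left)
  qed
  finally show ?thesis .
qed

text \<open>The regression part is deterministic and the noise has mean 0. For a zero denominator
  both sides are 0 by the convention x / 0 = 0.\<close>

lemma centered_g_est:
  "g_est g eps K h n x \<omega> - (\<integral>\<omega>'. g_est g eps K h n x \<omega>' \<partial>M)
   = (\<Sum>i\<in>Lambda_n n. eps i \<omega> * K ((1 / h n) *\<^sub>R (x - scaled_index n i)))
     / (\<Sum>i\<in>Lambda_n n. K ((1 / h n) *\<^sub>R (x - scaled_index n i)))"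
proof -
  define k where "k i = K ((1 / h n) *\<^sub>R (x - scaled_index n i))" for i
  define D where "D = (\<Sum>i\<in>Lambda_n n. k i)"
  have eq: "g_est g eps K h n x \<omega> = (\<Sum>i\<in>Lambda_n n. g (scaled_index n i) * k i) / D + (\<Sum>i\<in>Lambda_n n. eps i \<omega> * k i) / D" for \<omega>
    unfolding g_est_def k_def[symmetric] D_def[symmetric] by (simp add: distrib_right sum.distrib add_divide_distrib)
  have "(\<integral>\<omega>. (\<Sum>i\<in>Lambda_n n. eps i \<omega> * k i) \<partial>M) = 0"
    using eps_integrable eps_mean by (subst Bochner_Integration.integral_sum) auto
  then have "(\<integral>\<omega>'. g_est g eps K h n x \<omega>' \<partial>M) = (\<Sum>i\<in>Lambda_n n. g (scaled_index n i) * k i) / D"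
    unfolding eq using eps_integrable by (subst Bochner_Integration.integral_add) (auto simp: prob_space)
  then show ?thesis unfolding eq by (simp add: k_def D_def)
qed

end

section \<open>Almost sure bounds by Borel-Cantelli\<close>

context kernel_field
begin

text \<open>The sums increase with n, so powers of two suffice, and there the normalised
  expectations are geometric with ratio 2^(-\<delta>). The factor 2 inside the power pays for
  rounding n up to a power of two.\<close>

lemma abs_sum_growth:
  assumes \<delta>: "\<delta> > 0"
  shows "AE \<omega> in M. eventually (\<lambda>n. (\<Sum>i\<in>Lambda_n n. \<bar>eps i \<omega>\<bar>) \<le> (2 * real n) powr (real CARD('d) + \<delta>)) sequentially"
proof -
  define A where "A n \<omega> = (\<Sum>i\<in>Lambda_n n. \<bar>eps i \<omega>\<bar>)" for n \<omega>
  define e where "e = real CARD('d) + \<delta>"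
  define m where "m = (\<integral>\<omega>. \<bar>eps 0 \<omega>\<bar> \<partial>M)"
  define Z where "Z k \<omega> = A (2 ^ k) \<omega> / (2 ^ k) powr e" for k \<omega>
  have iA: "integrable M (A n)" for n
    unfolding A_def[abs_def] using eps_integrable by (intro Bochner_Integration.integrable_sum) auto
  have A: "(\<integral>\<omega>. A n \<omega> \<partial>M) = real n ^ CARD('d) * m" for n
  proof -
    have "(\<integral>\<omega>. A n \<omega> \<partial>M) = (\<Sum>i\<in>(Lambda_n n :: (int, 'd) vec set). \<integral>\<omega>. \<bar>eps i \<omega>\<bar> \<partial>M)"
      unfolding A_def using eps_integrable by (intro Bochner_Integration.integral_sum) auto
    also have "\<dots> = (\<Sum>i\<in>(Lambda_n n :: (int, 'd) vec set). m)"
      unfolding m_def by (intro sum.cong refl eps_abs_integral)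
    finally show ?thesis by (simp add: Lambda_n_card)
  qed
  have Zint: "(\<integral>\<omega>. Z k \<omega> \<partial>M) = m * (2 powr - \<delta>) ^ k" for k
  proof -
    have "(2 ^ k :: real) ^ CARD('d) / (2 ^ k) powr e = (2 ^ k) powr (- \<delta>)"
      by (simp add: e_def powr_add powr_minus powr_realpow field_simps)
    also have "\<dots> = (2 powr - \<delta>) ^ k" by (simp add: powr_powr mult.commute flip: powr_realpow)
    finally have "(2 ^ k :: real) ^ CARD('d) * m / (2 ^ k) powr e = m * (2 powr - \<delta>) ^ k" by (metis mult.commute times_divide_eq_right)
    then show ?thesis unfolding Z_def by (simp add: A)
  qed
  have "norm (2 powr - \<delta>) < 1" using \<delta> by (simp add: powr_minus inverse_less_1_iff)
  then have "summable (\<lambda>k. m * (2 powr - \<delta>) ^ k)" by (intro summable_mult summable_geometric)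
  moreover have "integrable M (Z k)" for k unfolding Z_def[abs_def] using iA by simp
  moreover have "Z k \<omega> \<ge> 0" for k \<omega> by (simp add: Z_def A_def sum_nonneg)
  ultimately have "AE \<omega> in M. eventually (\<lambda>k. Z k \<omega> \<le> 1) sequentially"
    by (intro AE_eventually_le_one_of_summable[where b = "\<lambda>k. m * (2 powr - \<delta>) ^ k"]) (simp_all only: Zint order.refl eventually_True)
  then show ?thesis
  proof eventually_elim
    fix \<omega> assume "eventually (\<lambda>k. Z k \<omega> \<le> 1) sequentially"
    then obtain N where N: "\<And>k. k \<ge> N \<Longrightarrow> Z k \<omega> \<le> 1" by (auto simp: eventually_sequentially)
    have "A n \<omega> \<le> (2 * real n) powr e" if n: "n \<ge> 2 ^ N" for n
    proof -
      have "n \<ge> 1" using n by (meson one_le_numeral one_le_power order.trans)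
      then obtain k where k: "2 ^ k \<le> n" "n < 2 ^ (k + 1)" using ex_power_ivl1[of 2 n] by auto
      \<comment> \<open>The bound is applied at the enclosing power 2^(k + 1), so it is k + 1 that
        must reach N.\<close>
      then have "(2::nat) ^ N < 2 ^ (k + 1)" using n by linarith
      then have "N \<le> k + 1" by (simp add: power_strict_increasing_iff del: power_Suc add_2_eq_Suc')
      have "A n \<omega> \<le> A (2 ^ (k + 1)) \<omega>"
        unfolding A_def using k Lambda_n_mono[of n "2 ^ (k + 1)"] Lambda_n_card(1) by (intro sum_mono2) auto
      also have "\<dots> \<le> (2 ^ (k + 1)) powr e"
        using N[OF \<open>N \<le> k + 1\<close>] unfolding Z_def by (simp add: divide_le_eq)
      also have "\<dots> \<le> (2 * real n) powr e"
      proof (rule powr_mono2)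
        have "(2::real) ^ k = real (2 ^ k)" by simp
        also have "\<dots> \<le> real n" using k(1) by (simp only: of_nat_le_iff)
        finally show "(2::real) ^ (k + 1) \<le> 2 * real n" by simp
      qed (use \<delta> in \<open>auto simp: e_def\<close>)
      finally show ?thesis .
    qed
    then show "eventually (\<lambda>n. (\<Sum>i\<in>Lambda_n n. \<bar>eps i \<omega>\<bar>) \<le> (2 * real n) powr (real CARD('d) + \<delta>)) sequentially"
      unfolding eventually_sequentially A_def e_def by blast
  qed
qed

text \<open>Up to logarithms the grid moment sum has expectation at most of order n^(d \<mu>) (n
  h)^(d p / 2), grid size times box moments. Divided by the p-th power of the target this is n^(-1 -
  \<tau>) times logarithms, which is summable.\<close>

lemma grid_moment_eventually:
  fixes a \<mu> \<tau> :: real and h :: "nat \<Rightarrow> real"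
  defines "d \<equiv> real CARD('d)"
  assumes \<tau>: "\<tau> > 0" and \<mu>: "\<mu> \<ge> 0" "d * \<mu> - a * p \<le> - 1 - \<tau>"
    and h: "eventually (\<lambda>n. h n \<le> 1) sequentially" "eventually (\<lambda>n. real n * h n \<ge> 1) sequentially"
  shows "AE \<omega> in M. eventually (\<lambda>n. (2 * (real (depth (n * h n)) + 1)) ^ CARD('d)
      * grid_moment_sum n (h n) (nat \<lceil>real n powr \<mu>\<rceil>) \<omega> powr (1 / p) \<le> real n powr a * (n * h n) powr (d / 2)) sequentially"
proof -
  define R where "R n = nat \<lceil>real n powr \<mu>\<rceil>" for n
  define e where "e n = real (depth (n * h n)) + 1" for n
  \<comment> \<open>Bounds \<open>e n\<close>, because h n <= 1 keeps the depth below the binary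
    logarithm of 10 n.\<close>
  define L where "L n = ln (10 * real n) / ln 2 + 1" for n
  \<comment> \<open>Chosen so that \<open>Z n \<omega> \<le> 1\<close> is the p-th power of the
    claimed inequality.\<close>
  define q where "q n = (2 * e n) powr (d * p) / (real n powr (a * p) * (n * h n) powr (d * p / 2))" for n
  define Z where "Z n \<omega> = q n * grid_moment_sum n (h n) (R n) \<omega>" for n \<omega>
  define \<kappa> where "\<kappa> = (2 * p * (p - 1) * C\<^sup>2 * dep_total) powr (p / 2)"
  define B where "B = \<kappa> * 3 powr d * 10 powr (d * p / 2) * 2 powr (d * p)"
  have d: "d \<ge> 1" unfolding d_def by (simp add: Suc_leI)
  have q: "q n \<ge> 0" for n by (simp add: q_def)
  have e: "e n \<ge> 1" for n by (simp add: e_def)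
  have pw: "x ^ CARD('d) = x powr d" if "x > 0" for x :: real using that by (simp add: d_def powr_realpow)
  have ev: "eventually (\<lambda>n. n \<ge> 1 \<and> h n \<le> 1 \<and> real n * h n \<ge> 1) sequentially"
    using h eventually_ge_at_top[of "1::nat"] by eventually_elim auto
  have bound: "(\<integral>\<omega>. Z n \<omega> \<partial>M) \<le> B * (real n powr (- 1 - \<tau>) * L n powr (d + d * p))"
    if n: "n \<ge> 1" "h n \<le> 1" "real n * h n \<ge> 1" for n
  proof -
    define H where "H = real n * h n"
    have H: "H \<ge> 1" "H \<le> n" using n mult_left_mono[of "h n" 1 "real n"] by (auto simp: H_def)
    have eL: "e n \<le> L n"
    proof -
      have "real (depth H) = log 2 (2 ^ depth H)" by simp
      also have "\<dots> \<le> log 2 (10 * real n)" using depth_bounds(2)[OF H(1)] H by (subst log_le_cancel_iff) auto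
      finally show ?thesis by (simp add: e_def L_def H_def log_def)
    qed
    have f1: "(real (R n) + 1) ^ CARD('d) \<le> 3 powr d * real n powr (\<mu> * d)"
    proof -
      have "real n powr \<mu> \<ge> 1" using n \<mu> by (intro ge_one_powr_ge_zero) auto
      then have "real (R n) + 1 \<le> 3 * real n powr \<mu>" unfolding R_def by linarith
      then have "(real (R n) + 1) powr d \<le> (3 * real n powr \<mu>) powr d" using d by (intro powr_mono2) auto
      then show ?thesis by (simp add: pw powr_mult powr_powr)
    qed
    have f2: "(e n * 2 powr (depth H * (p / 2))) ^ CARD('d) \<le> e n powr d * (10 powr (d * p / 2) * H powr (d * p / 2))"
    proof -
      have "(2 powr (depth H * (p / 2))) powr d = (2 ^ depth H) powr (d * p / 2)"
        by (simp add: powr_powr mult_ac flip: powr_realpow)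
      also have "\<dots> \<le> (10 * H) powr (d * p / 2)" using depth_bounds(2)[OF H(1)] d p_gt by (intro powr_mono2) auto
      also have "\<dots> = 10 powr (d * p / 2) * H powr (d * p / 2)" by (simp add: powr_mult)
      finally have "e n powr d * (2 powr (depth H * (p / 2))) powr d \<le> e n powr d * (10 powr (d * p / 2) * H powr (d * p / 2))"
        by (intro mult_left_mono) auto
      moreover have "e n * 2 powr (depth H * (p / 2)) > 0" using e[of n] by simp
      ultimately show ?thesis by (simp add: pw powr_mult)
    qed
    have "(\<integral>\<omega>. Z n \<omega> \<partial>M) = q n * (\<integral>\<omega>. grid_moment_sum n (h n) (R n) \<omega> \<partial>M)" by (simp add: Z_def)
    also have "\<dots> \<le> q n * ((real (R n) + 1) ^ CARD('d) * (\<kappa> * (e n * 2 powr (depth H * (p / 2))) ^ CARD('d)))"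
      using grid_moment_sum_integral(2)[of n "h n" "R n"] unfolding \<kappa>_def e_def H_def by (intro mult_left_mono q)
    also have "\<dots> \<le> q n * ((3 powr d * real n powr (\<mu> * d)) * (\<kappa> * (e n powr d * (10 powr (d * p / 2) * H powr (d * p / 2)))))"
      using f1 f2 q e[of n] by (intro mult_left_mono mult_mono) (auto simp: \<kappa>_def)
    also have "\<dots> = B * (real n powr (\<mu> * d - a * p) * e n powr (d + d * p))"
      using n H e[of n] unfolding q_def H_def[symmetric] B_def by (simp add: powr_mult powr_add powr_diff)
    also have "\<dots> \<le> B * (real n powr (- 1 - \<tau>) * L n powr (d + d * p))"
    proof (intro mult_left_mono mult_mono)
      show "real n powr (\<mu> * d - a * p) \<le> real n powr (- 1 - \<tau>)" using \<mu> n by (intro powr_mono) (auto simp: mult.commute)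
      show "e n powr (d + d * p) \<le> L n powr (d + d * p)" using eL e[of n] d p_gt by (intro powr_mono2) auto
    qed (auto simp: B_def \<kappa>_def)
    finally show ?thesis .
  qed
  have "summable (\<lambda>n. B * (real n powr (- 1 - \<tau>) * L n powr (d + d * p)))"
  proof (rule summable_mult, rule summable_comparison_test_bigo)
    \<comment> \<open>Half of \<tau> is given away to absorb the logarithms.\<close>
    show "summable (\<lambda>n. norm (real n powr (- 1 - \<tau> / 2)))" using \<tau> by (simp add: summable_real_powr_iff)
    show "(\<lambda>n. real n powr (- 1 - \<tau>) * L n powr (d + d * p)) \<in> O(\<lambda>n. real n powr (- 1 - \<tau> / 2))"
      unfolding L_def using \<tau> by real_asymp
  qed
  moreover have "eventually (\<lambda>n. (\<integral>\<omega>. Z n \<omega> \<partial>M) \<le> B * (real n powr (- 1 - \<tau>) * L n powr (d + d * p))) sequentially"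
    using ev by eventually_elim (use bound in auto)
  ultimately have "AE \<omega> in M. eventually (\<lambda>n. Z n \<omega> \<le> 1) sequentially"
    using q grid_moment_sum_nonneg grid_moment_sum_integral(1)
    by (intro AE_eventually_le_one_of_summable) (auto simp: Z_def[abs_def])
  then show ?thesis
  proof eventually_elim
    fix \<omega> assume "eventually (\<lambda>n. Z n \<omega> \<le> 1) sequentially"
    with ev show "eventually (\<lambda>n. (2 * (real (depth (n * h n)) + 1)) ^ CARD('d)
      * grid_moment_sum n (h n) (nat \<lceil>real n powr \<mu>\<rceil>) \<omega> powr (1 / p) \<le> real n powr a * (n * h n) powr (d / 2)) sequentially"
    proof eventually_elim
      fix n assume n: "n \<ge> 1 \<and> h n \<le> 1 \<and> real n * h n \<ge> 1" and Z: "Z n \<omega> \<le> 1"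
      define G where "G = grid_moment_sum n (h n) (R n) \<omega>"
      define H where "H = real n * h n"
      have G0: "G \<ge> 0" unfolding G_def by (rule grid_moment_sum_nonneg)
      have H: "H > 0" using n by (simp add: H_def)
      have "(2 * e n) powr (d * p) * G \<le> real n powr (a * p) * H powr (d * p / 2)"
        using Z n H unfolding Z_def q_def G_def[symmetric] H_def[symmetric] by (simp add: field_simps)
      then have "((2 * e n) powr (d * p) * G) powr (1 / p) \<le> (real n powr (a * p) * H powr (d * p / 2)) powr (1 / p)"
        using p_gt G0 by (intro powr_mono2) auto
      then have "(2 * e n) powr d * G powr (1 / p) \<le> real n powr a * H powr (d / 2)"
        using p_gt G0 by (simp add: powr_mult powr_powr)
      then show "(2 * (real (depth (n * h n)) + 1)) ^ CARD('d)
        * grid_moment_sum n (h n) (nat \<lceil>real n powr \<mu>\<rceil>) \<omega> powr (1 / p) \<le> real n powr a * (n * h n) powr (d / 2)"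
        using e[of n] by (simp add: pw G_def H_def R_def e_def)
    qed
  qed
qed

end

text \<open>For mesh n^(-\<mu>) and bandwidth at least n^(-\<theta>), the first claim makes the mesh
  finer than the bandwidth, the second gives summability over the grid with margin d \<theta> / 2,
  and the third keeps the freezing error, with \<delta> = \<theta> / 2, below the target.\<close>

lemma rate_exponents:
  fixes a p d \<theta> :: real
  assumes d: "d \<ge> 1" and p: "p > 2" and \<theta>: "\<theta> > 0"
    and le: "\<theta> \<le> (2 * a * (d + p) - d ^ 2 - 2) / (d * (3 * d + 2))"
  defines "\<mu> \<equiv> (a * p - 1) / d - \<theta> / 2"
  shows "\<theta> \<le> \<mu>" and "d * \<mu> - a * p = - 1 - d * \<theta> / 2"
    and "- \<mu> + (d + \<theta> / 2) \<le> a + d / 2 - \<theta> * (1 + d / 2)"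
proof -
  have main: "\<theta> * (d * (3 * d + 2)) \<le> 2 * a * (d + p) - d ^ 2 - 2"
    using le d by (simp add: pos_le_divide_eq)
  have dd: "d * d \<ge> d" using d by simp
  have \<theta>dd: "\<theta> * (d * d) \<ge> \<theta> * d" using mult_left_mono[OF dd, of \<theta>] \<theta> by simp
  show d\<mu>: "d * \<mu> - a * p = - 1 - d * \<theta> / 2" using d by (simp add: \<mu>_def field_simps)
  \<comment> \<open>The first claim amounts to \<open>X \<le> a * p\<close>.\<close>
  define X where "X = 1 + 3 / 2 * d * \<theta>"
  have "(d + p) * X \<le> (d + p) * (a * p)"
  proof -
    \<comment> \<open>Chosen so that \<open>main\<close> reads
      \<open>E + X \<le> a * (d + p)\<close>. Together with
      \<open>d * X \<le> 2 * E \<le> p * E\<close> this gives the bound, and p > 2 enters in the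
      last comparison.\<close>
    define E where "E = d * d / 2 + \<theta> * (3 / 2 * (d * d) - d / 2)"
    have E: "E \<ge> 0" unfolding E_def using d \<theta> dd by (intro add_nonneg_nonneg mult_nonneg_nonneg) auto
    have "d * X = d + 3 / 2 * (\<theta> * (d * d))" "2 * E = d * d + 3 * (\<theta> * (d * d)) - \<theta> * d"
      by (simp_all add: E_def X_def algebra_simps)
    moreover have "\<theta> * d \<ge> 0" using \<theta> d by simp
    ultimately have "d * X \<le> 2 * E" using dd \<theta>dd by linarith
    also have "\<dots> \<le> p * E" using E p by (intro mult_right_mono) auto
    finally have "(d + p) * X \<le> p * (E + X)" by (simp add: distrib_left distrib_right)
    also have "\<dots> \<le> p * (a * (d + p))"
      using main p unfolding E_def X_def by (intro mult_left_mono) (auto simp: algebra_simps power2_eq_square)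
    finally show ?thesis by (simp add: mult_ac)
  qed
  then have "1 + 3 / 2 * d * \<theta> \<le> a * p" using d p by (simp add: X_def)
  then show "\<theta> \<le> \<mu>" using d by (simp add: \<mu>_def field_simps)
  \<comment> \<open>The difference of the two sides is half the slack of \<open>main\<close> plus
    \<open>\<theta> * (d * d - d)\<close>, which is nonnegative because d >= 1.\<close>
  have "d * (- \<mu> + (d + \<theta> / 2)) \<le> d * (a + d / 2 - \<theta> * (1 + d / 2))"
    using main \<theta>dd d\<mu> by (simp add: algebra_simps power2_eq_square)
  then show "- \<mu> + (d + \<theta> / 2) \<le> a + d / 2 - \<theta> * (1 + d / 2)" using d by simp
qed

section \<open>The uniform almost sure rate\<close>

theorem theorem1:
  fixes M :: "'a measure"
    and eps :: "(int, 'd::{finite,linorder}) vec \<Rightarrow> 'a \<Rightarrow> real"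
    and g :: "(real, 'd) vec \<Rightarrow> real"
    and K :: "(real, 'd) vec \<Rightarrow> real"
    and h :: "nat \<Rightarrow> real"
    and p \<theta>1 \<theta>2 a b \<eta> c C :: real
  defines "d \<equiv> real CARD('d)"
  assumes "prob_space M"
    and meas: "\<And>i. eps i \<in> borel_measurable M"
    and stat: "strictly_stationary M eps"
    and mean0: "integral\<^sup>L M (eps 0) = 0"
    \<comment> \<open>K is a probability density on R^d\<close>
    and K_meas: "K \<in> borel_measurable lborel"
    and K_dens: "(K has_integral 1) UNIV"
    \<comment> \<open>(A1)\<close>
    and K_sym: "\<And>x. K (- x) = K x"
    and K_nonneg: "\<And>x. K x \<ge> 0"
    and K_supp: "\<And>x. supnormR x > 1 \<Longrightarrow> K x = 0"
    and \<eta>_pos: "\<eta> > 0"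
    and K_lip: "\<And>x y. supnormR x \<le> 1 \<Longrightarrow> supnormR y \<le> 1 \<Longrightarrow> \<bar>K x - K y\<bar> \<le> \<eta> * supnormR (x - y)"
    and cC: "c > 0" "C > 0"
    and K_bounds: "\<And>x. supnormR x \<le> 1 \<Longrightarrow> c \<le> K x \<and> K x \<le> C"
    \<comment> \<open>(C3) for p > 2\<close>
    and p_gt: "p > 2"
    and Lp: "integrable M (\<lambda>\<omega>. \<bar>eps 0 \<omega>\<bar> powr p)"
    and C3_int: "\<And>k. k \<in> Vset 0 1 \<Longrightarrow>
        integrable M (\<lambda>\<omega>. \<bar>eps k \<omega> * real_cond_exp M (gen_sigma M eps (Vset 0 (supnormZ k))) (eps 0) \<omega>\<bar> powr (p / 2))"
    and C3_sum: "(\<lambda>k. Lnorm M (p / 2)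
          (\<lambda>\<omega>. eps k \<omega> * real_cond_exp M (gen_sigma M eps (Vset 0 (supnormZ k))) (eps 0) \<omega>))
        summable_on Vset 0 1"
    \<comment> \<open>bandwidth\<close>
    and \<theta>_pos: "\<theta>1 > 0" "\<theta>2 > 0"
    and h_def: "\<And>n. h n = real n powr (- \<theta>2) * ln (real n) powr \<theta>1"
    and h_lim: "h \<longlonglongrightarrow> 0"
    and nh_lim: "filterlim (\<lambda>n. real n * h n) at_top sequentially"
    and ab: "a \<ge> 0" "b \<ge> 0"
    and \<theta>_ge: "(2 * a * (d + p) - d ^ 2 - 2) / (d * (3 * d + 2)) \<ge> \<theta>2"
    and cond2: "d * (3 * d + 2) * \<theta>1 + 2 * (d + p) * b > 2"
  shows "O_as M
     (\<lambda>n \<omega>. SUP x\<in>unit_cube. \<bar>g_est g eps K h n x \<omega> - (\<integral>\<omega>'. g_est g eps K h n x \<omega>' \<partial>M)\<bar>)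
     (\<lambda>n. real n powr a * ln (real n) powr b / (real n * h n) powr (d / 2))"
proof -
  interpret prob_space M by fact
  interpret kernel_field M eps p K \<eta> c C
    by unfold_locales (fact meas stat mean0 p_gt Lp C3_int C3_sum K_nonneg K_supp \<eta>_pos K_lip cC K_bounds)+
  define \<mu> where "\<mu> = (a * p - 1) / d - \<theta>2 / 2"
  define \<delta> where "\<delta> = \<theta>2 / 2"
  define R where "R n = nat \<lceil>real n powr \<mu>\<rceil>" for n
  \<comment> \<open>The 1 is the box part, \<open>\<eta> * 2 powr (d + \<delta>)\<close> the
    freezing error, whose 2 comes from the growth bound for the absolute sums, and
    \<open>2 powr d / c\<close> comes from the lower bound \<open>c * (H / 2) powr d\<close> for the
    denominator.\<close>
  define lam where "lam = (1 + \<eta> * 2 powr (d + \<delta>)) * 2 powr d / c"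
  have d1: "d \<ge> 1" unfolding d_def by (simp add: Suc_leI)
  note ex = rate_exponents[OF d1 p_gt \<theta>_pos(2) \<theta>_ge, folded \<mu>_def]
  have \<mu>0: "\<mu> > 0" using ex(1) \<theta>_pos by linarith
  have lam: "lam > 0" unfolding lam_def using \<eta>_pos cC by (auto intro!: divide_pos_pos mult_pos_pos add_pos_pos)
  have evh: "eventually (\<lambda>n. h n \<le> 1 / 2) sequentially"
    using order_tendstoD(2)[OF h_lim, of "1 / 2"] by (auto elim: eventually_mono)
  have evH: "eventually (\<lambda>n. real n * h n \<ge> 2) sequentially"
    using nh_lim by (simp add: filterlim_at_top)
  have "AE \<omega> in M. eventually (\<lambda>n. (2 * (real (depth (n * h n)) + 1)) ^ CARD('d)
      * grid_moment_sum n (h n) (nat \<lceil>real n powr \<mu>\<rceil>) \<omega> powr (1 / p) \<le> real n powr a * (n * h n) powr (real CARD('d) / 2)) sequentially"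
  proof (rule grid_moment_eventually[where \<tau> = "d * \<theta>2 / 2"])
    show "eventually (\<lambda>n. h n \<le> 1) sequentially" using evh by eventually_elim auto
    show "eventually (\<lambda>n. real n * h n \<ge> 1) sequentially" using evH by eventually_elim auto
    show "real CARD('d) * \<mu> - a * p \<le> - 1 - d * \<theta>2 / 2" using ex(2) unfolding d_def by simp
  qed (use d1 \<theta>_pos \<mu>0 in auto)
  moreover have "AE \<omega> in M. eventually (\<lambda>n. (\<Sum>i\<in>Lambda_n n. \<bar>eps i \<omega>\<bar>) \<le> (2 * real n) powr (real CARD('d) + \<delta>)) sequentially"
    using \<theta>_pos by (intro abs_sum_growth) (simp add: \<delta>_def)
  ultimately have "AE \<omega> in M. limsup (\<lambda>n. ereal (\<bar>SUP x\<in>unit_cube. \<bar>g_est g eps K h n x \<omega> - (\<integral>\<omega>'. g_est g eps K h n x \<omega>' \<partial>M)\<bar>\<bar>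
     / (real n powr a * ln (real n) powr b / (real n * h n) powr (d / 2)))) \<le> ereal lam"
  proof eventually_elim
    fix \<omega>
    assume moments: "eventually (\<lambda>n. (2 * (real (depth (n * h n)) + 1)) ^ CARD('d)
        * grid_moment_sum n (h n) (nat \<lceil>real n powr \<mu>\<rceil>) \<omega> powr (1 / p) \<le> real n powr a * (n * h n) powr (real CARD('d) / 2)) sequentially"
      and growth: "eventually (\<lambda>n. (\<Sum>i\<in>Lambda_n n. \<bar>eps i \<omega>\<bar>) \<le> (2 * real n) powr (real CARD('d) + \<delta>)) sequentially"
    define Z where "Z n x = g_est g eps K h n x \<omega> - (\<integral>\<omega>'. g_est g eps K h n x \<omega>' \<partial>M)" for n x
    have "eventually (\<lambda>n. \<bar>SUP x\<in>unit_cube. \<bar>Z n x\<bar>\<bar> / (real n powr a * ln (real n) powr b / (real n * h n) powr (d / 2)) \<le> lam) sequentially"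
      using moments growth evh evH eventually_ge_at_top[of "3::nat"]
    proof eventually_elim
      fix n
      assume mom: "(2 * (real (depth (n * h n)) + 1)) ^ CARD('d)
          * grid_moment_sum n (h n) (nat \<lceil>real n powr \<mu>\<rceil>) \<omega> powr (1 / p) \<le> real n powr a * (n * h n) powr (real CARD('d) / 2)"
        and gr: "(\<Sum>i\<in>Lambda_n n. \<bar>eps i \<omega>\<bar>) \<le> (2 * real n) powr (real CARD('d) + \<delta>)"
        and hn: "h n \<le> 1 / 2" and Hn: "real n * h n \<ge> 2" and n: "n \<ge> 3"
      define H where "H = real n * h n"
      have n1: "real n \<ge> 1" using n by simp
      \<comment> \<open>From n = 3 on the logarithm is at least 1, so its nonnegative powers are
        bounded below by 1.\<close>
      have "exp 1 \<le> real n" using exp_le n by linarith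
      then have ln1: "ln (real n) \<ge> 1" using n by (subst ln_ge_iff) auto
      have h_ge: "real n powr (- \<theta>2) \<le> h n"
      proof -
        have "real n powr (- \<theta>2) * 1 \<le> real n powr (- \<theta>2) * ln (real n) powr \<theta>1"
          using ln1 \<theta>_pos by (intro mult_left_mono ge_one_powr_ge_zero) auto
        then show ?thesis by (simp add: h_def)
      qed
      have h0: "h n > 0" using h_ge n by (intro less_le_trans[OF _ h_ge]) auto
      have H0: "H > 0" using Hn by (simp add: H_def)
      have R_ge: "real n powr \<mu> \<le> real (R n)" unfolding R_def by linarith
      have "real n powr \<mu> > 0" using n by simp
      with R_ge have R0: "R n > 0" by (metis of_nat_0_less_iff order_less_le_trans)
      have "1 / real (R n) \<le> 1 / real n powr \<mu>" using R_ge R0 n by (intro divide_left_mono) auto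
      also have "\<dots> = real n powr (- \<mu>)" by (simp add: powr_minus_divide)
      finally have R_inv: "1 / real (R n) \<le> real n powr (- \<mu>)" .
      also have "\<dots> \<le> real n powr (- \<theta>2)" using ex(1) n1 by (intro powr_mono) auto
      finally have Rh: "1 / real (R n) \<le> h n" using h_ge by linarith
      \<comment> \<open>The freezing error carries the Lipschitz factor \<open>1 / h n\<close>, so
        mesh times absolute sums must beat the target by one more factor \<open>h n\<close>.\<close>
      have rem: "real n powr (- \<mu>) * real n powr (d + \<delta>) \<le> real n powr a * H powr (d / 2) * h n"
      proof -
        have "real n powr (- \<mu>) * real n powr (d + \<delta>) = real n powr (- \<mu> + (d + \<delta>))" by (simp only: powr_add)
        also have "\<dots> \<le> real n powr (a + d / 2 - \<theta>2 * (1 + d / 2))"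
          using ex(3) n1 unfolding \<delta>_def by (intro powr_mono) auto
        also have "\<dots> = real n powr a * real n powr (d / 2) * (real n powr (- \<theta>2)) powr (1 + d / 2)"
          by (simp only: powr_powr powr_add[symmetric]) (simp add: algebra_simps)
        also have "\<dots> \<le> real n powr a * real n powr (d / 2) * h n powr (1 + d / 2)"
          using h_ge d1 by (intro mult_left_mono powr_mono2) auto
        also have "\<dots> = real n powr a * H powr (d / 2) * h n"
          using h0 by (simp add: H_def powr_mult powr_add)
        finally show ?thesis .
      qed
      have noise: "\<bar>\<Sum>i\<in>Lambda_n n. eps i \<omega> * K ((1 / h n) *\<^sub>R (x - scaled_index n i))\<bar>
          \<le> (1 + \<eta> * 2 powr (d + \<delta>)) * (real n powr a * H powr (d / 2))" if x: "x \<in> unit_cube" for x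
      proof -
        have "\<bar>\<Sum>i\<in>Lambda_n n. eps i \<omega> * K ((1 / h n) *\<^sub>R (x - scaled_index n i))\<bar>
          \<le> (2 * (real (depth (n * h n)) + 1)) ^ CARD('d) * grid_moment_sum n (h n) (R n) \<omega> powr (1 / p)
            + \<eta> / (R n * h n) * (\<Sum>i\<in>Lambda_n n. \<bar>eps i \<omega>\<bar>)"
          using x n R0 Rh Hn by (intro noise_sum_le) auto
        also have "(2 * (real (depth (n * h n)) + 1)) ^ CARD('d) * grid_moment_sum n (h n) (R n) \<omega> powr (1 / p)
          \<le> real n powr a * H powr (d / 2)" using mom by (simp add: R_def d_def H_def)
        also have "\<eta> / (R n * h n) * (\<Sum>i\<in>Lambda_n n. \<bar>eps i \<omega>\<bar>) \<le> \<eta> / (R n * h n) * (2 * real n) powr (d + \<delta>)"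
          using gr \<eta>_pos h0 unfolding d_def by (intro mult_left_mono) auto
        also have "\<dots> = \<eta> * 2 powr (d + \<delta>) / h n * (1 / real (R n) * real n powr (d + \<delta>))"
          by (simp add: powr_mult mult_ac)
        also have "\<dots> \<le> \<eta> * 2 powr (d + \<delta>) / h n * (real n powr a * H powr (d / 2) * h n)"
          using \<eta>_pos h0 R_inv by (intro mult_left_mono order.trans[OF mult_right_mono[OF R_inv] rem]) auto
        also have "\<dots> = \<eta> * 2 powr (d + \<delta>) * (real n powr a * H powr (d / 2))" using h0 by simp
        finally show ?thesis by (simp add: distrib_right)
      qed
      define V where "V = real n powr a * ln (real n) powr b / (real n * h n) powr (d / 2)"
      have V: "V > 0" unfolding V_def using n ln1 Hn by (intro divide_pos_pos mult_pos_pos) auto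
      have Zle: "\<bar>Z n x\<bar> \<le> lam * V" if x: "x \<in> unit_cube" for x
      proof -
        define D where "D = (\<Sum>i\<in>Lambda_n n. K ((1 / h n) *\<^sub>R (x - scaled_index n i)))"
        have "c * (H / 2) powr d \<le> D"
          using kernel_sum_ge[OF x _ hn Hn] n H0 by (simp add: D_def H_def d_def powr_realpow)
        moreover have "c * (H / 2) powr d > 0" using cC H0 by simp
        ultimately have "\<bar>Z n x\<bar> \<le> (1 + \<eta> * 2 powr (d + \<delta>)) * (real n powr a * H powr (d / 2)) / (c * (H / 2) powr d)"
          unfolding Z_def centered_g_est abs_divide D_def[symmetric] using noise[OF x] \<eta>_pos
          by (intro frac_le) auto
        \<comment> \<open>Dividing the noise bound of order H^(d/2) by a denominator of order H^d
          leaves H^(-d/2), the rate in V.\<close>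
        also have "\<dots> = lam * (real n powr a * 1 / H powr (d / 2))"
        proof -
          have "H powr d = H powr (d / 2) * H powr (d / 2)" by (simp flip: powr_add)
          then show ?thesis using H0 cC by (simp add: lam_def powr_divide field_simps)
        qed
        also have "\<dots> \<le> lam * V"
          unfolding V_def H_def using ln1 ab lam
          by (intro mult_left_mono divide_right_mono ge_one_powr_ge_zero) auto
        finally show ?thesis .
      qed
      have ne: "(unit_cube :: (real, 'd) vec set) \<noteq> {}" by (auto simp: unit_cube_def intro!: exI[of _ 0])
      have "(SUP x\<in>unit_cube. \<bar>Z n x\<bar>) \<le> lam * V" using ne Zle by (intro cSUP_least) auto
      \<comment> \<open>\<open>O_as\<close> takes the absolute value of the supremum; a real
        supremum compares with its members only once the set is known to be bounded above.\<close>
      moreover have "0 \<le> (SUP x\<in>unit_cube. \<bar>Z n x\<bar>)"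
      proof -
        obtain x :: "(real, 'd) vec" where x: "x \<in> unit_cube" using ne by blast
        have "bdd_above ((\<lambda>x. \<bar>Z n x\<bar>) ` unit_cube)" using Zle by (intro bdd_aboveI[of _ "lam * V"]) auto
        then have "\<bar>Z n x\<bar> \<le> (SUP x\<in>unit_cube. \<bar>Z n x\<bar>)" using x by (intro cSUP_upper)
        then show ?thesis by linarith
      qed
      ultimately show "\<bar>SUP x\<in>unit_cube. \<bar>Z n x\<bar>\<bar> / (real n powr a * ln (real n) powr b / (real n * h n) powr (d / 2)) \<le> lam"
        using V unfolding V_def[symmetric] by (simp add: divide_le_eq)
    qed
    then show "limsup (\<lambda>n. ereal (\<bar>SUP x\<in>unit_cube. \<bar>g_est g eps K h n x \<omega> - (\<integral>\<omega>'. g_est g eps K h n x \<omega>' \<partial>M)\<bar>\<bar>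
     / (real n powr a * ln (real n) powr b / (real n * h n) powr (d / 2)))) \<le> ereal lam"
      unfolding Z_def by (intro Limsup_bounded) (auto elim: eventually_mono)
  qed
  then show ?thesis unfolding O_as_def using lam by blast
qed

end
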